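(* Let $(M,g)$ be an oriented 5-dimensional Riemannian spin manifold and $\eta$ a unit-length section of its spinor bundle. With the tensors $\mu,\lambda_l,\phi_l,V_\xi,\Theta_l$ ($l=1,2,3$) determined by $\nabla\eta$ as in the context, $$D\eta=(-4\mu+\phi_1)\eta-4\lambda_1\jmath_1\eta+(4\lambda_2+\phi_3)\jmath_2\eta+(4\lambda_3-\phi_2)\jmath_3\eta+\bigl(J_1(V_\xi+\Theta_1^\sharp)-J_2(\Theta_2^\sharp)-J_3(\Theta_3^\sharp)\bigr)\eta .$$
   Context: Spinors in dimension 5: Clifford convention $v\cdot v=-|v|^2$. $\Sigma(M)$ is the bundle associated to an irreducible real $\mathrm{Cl}_5$-module $W$ (real dimension 8), with invariant scalar product $\langle\cdot,\cdot\rangle$ for which vectors act skew-symmetrically, and spin connection $\nabla$. $\jmath_1$ is Clifford multiplication by the oriented unit volume form ($\jmath_1^2=-1$, commutes with vectors); $\jmath_2$ is a parallel isometry with $\jmath_2^2=-1$ anticommuting with Clifford multiplication by vectors; $\jmath_3=\jmath_1\jmath_2$. The Dirac operator is $D\eta=\sum_ie_i\nabla_{e_i}\eta$ for a local orthonormal frame. $\mathrm{SU}(2)$ structure of a unit spinor $\eta$: there is a rank-4 subbundle $\xi\subset TM$ such that $\xi\eta$ is the orthogonal complement of $\langle\eta,\jmath_1\eta,\jmath_2\eta,\jmath_3\eta\rangle$; define $J_k:\xi\to\xi$ by $J_k(X)\eta=\jmath_k(X\eta)$, and $\omega_k(X,Y)=g(J_kX_\xi,Y_\xi)$, $X_\xi$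 the orthogonal projection to $\xi$. $R$ is the unit vector field orthogonal to $\xi$ such that $TM=\xi\oplus\langle R\rangle$ as oriented bundles, $\xi$ oriented by $\omega_1^2|_\xi$; $\alpha=g(R,\cdot)$. Decomposition of $\nabla\eta$: there are unique $S\in\mathrm{End}(\xi)$, $V_\xi\in\xi$, $\Theta_l\in\xi^*$, $\phi_l\in C^\infty(M)$ with $\nabla_X\eta=S(X_\xi)\eta+\alpha(X)V_\xi\eta+\sum_{l=1}^3(\Theta_l(X_\xi)+\alpha(X)\phi_l)\jmath_l\eta$, where $X=X_\xi+\alpha(X)R$. Moreover $S=\mu\,\mathrm{I}+\sum_lS_l+\sum_l\lambda_lJ_l+S_0$ uniquely, with $\mu,\lambda_l$ functions, $S_k$ symmetric traceless, commuting with $J_k$ and anticommuting with $J_l$ for $l\ne k$, and $S_0$ skew-symmetric commuting with $J_1,J_2,J_3$. $\Theta^\sharp$ is the metric dual vector of $\Theta$. *)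

theory Defs
  imports "HOL-Analysis.Analysis"
begin

section \<open>Smooth maps between normed spaces\<close>

text \<open>\<open>Ck k S f\<close> is meant for open \<open>S\<close> and a finite-dimensional domain, where asking for all
  directional derivatives is the usual notion of being of class \<open>C^k\<close>.\<close>

primrec Ck :: "nat \<Rightarrow> 'a::real_normed_vector set \<Rightarrow> ('a \<Rightarrow> 'b::real_normed_vector) \<Rightarrow> bool" where
  "Ck 0 = (\<lambda>S f. continuous_on S f)"
| "Ck (Suc k) = (\<lambda>S f. (\<forall>x\<in>S. f differentiable (at x)) \<and>
      (\<forall>v. Ck k S (\<lambda>x. frechet_derivative f (at x) v)))"

definition C_infty :: "'a::real_normed_vector set \<Rightarrow> ('a \<Rightarrow> 'b::real_normed_vector) \<Rightarrow> bool" where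
  "C_infty S f \<longleftrightarrow> (\<forall>k. Ck k S f)"


section \<open>Oriented Riemannian spin 5-manifolds\<close>

text \<open>The manifold is the whole type \<open>'m\<close>. A chart is a pair of its domain and a map.
  \<^item> The tangent space at \<open>p\<close> is \<open>real^5\<close>, read through the preferred chart \<open>chart_at M p\<close>;
    a vector field is a function \<open>'m \<Rightarrow> real^5\<close>.
  \<^item> The spin structure is given by a cocycle: over the open set \<open>cover M i\<close> there is an oriented
    orthonormal frame \<open>frame M i p\<close> (an isometry from \<open>real^5\<close> to the tangent space at \<open>p\<close>), and
    \<open>lift M i j\<close> lifts the transition function from frame \<open>j\<close> to frame \<open>i\<close> to the spin group.
  \<^item> \<open>clif M\<close> is the Clifford module structure on \<open>'w\<close>.
  \<^item> The fibre of the spinor bundle at \<open>p\<close> is \<open>'w\<close>, read through the preferred trivialization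
    \<open>idx M p\<close>; a spinor field is a function \<open>'m \<Rightarrow> 'w\<close>.\<close>

record ('m, 'i, 'w) spin_data =
  atlas :: "('m set \<times> ('m \<Rightarrow> real^5)) set"
  metric :: "'m \<Rightarrow> real^5 \<Rightarrow> real^5 \<Rightarrow> real"
  cover :: "'i \<Rightarrow> 'm set"
  frame :: "'i \<Rightarrow> 'm \<Rightarrow> real^5 \<Rightarrow> real^5"
  lift :: "'i \<Rightarrow> 'i \<Rightarrow> 'm \<Rightarrow> 'w \<Rightarrow> 'w"
  clif :: "real^5 \<Rightarrow> 'w \<Rightarrow> 'w"

definition chart_at :: "('m, 'i, 'w) spin_data \<Rightarrow> 'm \<Rightarrow> 'm set \<times> ('m \<Rightarrow> real^5)" where
  "chart_at M p = (SOME c. c \<in> atlas M \<and> p \<in> fst c)"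

definition idx :: "('m, 'i, 'w) spin_data \<Rightarrow> 'm \<Rightarrow> 'i" where
  "idx M p = (SOME i. p \<in> cover M i)"

definition smooth_map_on ::
    "('m, 'i, 'w) spin_data \<Rightarrow> 'm set \<Rightarrow> ('m \<Rightarrow> 'b::real_normed_vector) \<Rightarrow> bool" where
  "smooth_map_on M U f \<longleftrightarrow>
     (\<forall>(V, \<psi>) \<in> atlas M. C_infty (\<psi> ` (U \<inter> V)) (f \<circ> inv_into V \<psi>))"

text \<open>\<open>mderiv M f p v\<close> is the differential of \<open>f\<close> at \<open>p\<close> applied to the tangent vector \<open>v\<close>.\<close>

definition mderiv ::
    "('m, 'i, 'w) spin_data \<Rightarrow> ('m \<Rightarrow> 'b::real_normed_vector) \<Rightarrow> 'm \<Rightarrow> real^5 \<Rightarrow> 'b" where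
  "mderiv M f p v =
     (case chart_at M p of (V, \<psi>) \<Rightarrow> frechet_derivative (f \<circ> inv_into V \<psi>) (at (\<psi> p)) v)"

text \<open>A vector field is smooth iff its components \<open>d\<phi>(X)\<close> in every chart \<open>(V, \<phi>)\<close> are.\<close>

definition smooth_field_on ::
    "('m, 'i, 'w) spin_data \<Rightarrow> 'm set \<Rightarrow> ('m \<Rightarrow> real^5) \<Rightarrow> bool" where
  "smooth_field_on M U X \<longleftrightarrow>
     (\<forall>(V, \<phi>) \<in> atlas M. smooth_map_on M (U \<inter> V) (\<lambda>p. mderiv M \<phi> p (X p)))"

text \<open>Together with the topology of \<open>'m\<close> being Hausdorff and second countable (see
  \<open>spin_manifold\<close>): the atlas makes \<open>'m\<close> an oriented smooth 5-manifold. As every chart is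
  oriented, the orientation of the tangent space at \<open>p\<close> is the standard one of \<open>real^5\<close>.\<close>

definition oriented_atlas :: "('m::topological_space, 'i, 'w) spin_data \<Rightarrow> bool" where
  "oriented_atlas M \<longleftrightarrow>
     (\<forall>p. \<exists>c \<in> atlas M. p \<in> fst c) \<and>
     (\<forall>(U, \<phi>) \<in> atlas M. open U \<and> open (\<phi> ` U) \<and> homeomorphism U (\<phi> ` U) \<phi> (inv_into U \<phi>)) \<and>
     (\<forall>(U, \<phi>) \<in> atlas M. \<forall>(V, \<psi>) \<in> atlas M.
        C_infty (\<psi> ` (U \<inter> V)) (\<phi> \<circ> inv_into V \<psi>) \<and>
        (\<forall>p \<in> U \<inter> V. det (matrix (frechet_derivative (\<phi> \<circ> inv_into V \<psi>) (at (\<psi> p)))) > 0))"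

definition riemannian_metric :: "('m::topological_space, 'i, 'w) spin_data \<Rightarrow> bool" where
  "riemannian_metric M \<longleftrightarrow>
     (\<forall>p. bilinear (metric M p) \<and>
        (\<forall>x y. metric M p x y = metric M p y x) \<and>
        (\<forall>x. x \<noteq> 0 \<longrightarrow> metric M p x x > 0)) \<and>
     (\<forall>U X Y. open U \<and> smooth_field_on M U X \<and> smooth_field_on M U Y \<longrightarrow>
        smooth_map_on M U (\<lambda>p. metric M p (X p) (Y p)))"

text \<open>By the universal property of the Clifford algebra, a module over it is the same as an action
  of vectors with \<open>v \<cdot> v = - |v|^2\<close>.\<close>

definition irreducible_Cl5_module :: "(real^5 \<Rightarrow> 'w::euclidean_space \<Rightarrow> 'w) \<Rightarrow> bool" where
  "irreducible_Cl5_module cl \<longleftrightarrow>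
     bilinear cl \<and>
     (\<forall>v w. cl v (cl v w) = - ((norm v)\<^sup>2 *\<^sub>R w)) \<and>
     (\<forall>L. subspace L \<and> (\<forall>v. cl v ` L \<subseteq> L) \<longrightarrow> L = {0} \<or> L = UNIV) \<and>
     DIM('w) = 8 \<and>
     (\<forall>v w w'. cl v w \<bullet> w' = - (w \<bullet> cl v w'))"

text \<open>The spin group consists of the products of an even number of unit vectors. The Clifford
  algebra is simple, hence acts faithfully, so the group can be taken inside \<open>End('w)\<close>.\<close>

definition Spin5 :: "(real^5 \<Rightarrow> 'w \<Rightarrow> 'w) \<Rightarrow> ('w \<Rightarrow> 'w) set" where
  "Spin5 cl = {foldr (\<lambda>v f. cl v \<circ> f) vs id | vs. even (length vs) \<and> (\<forall>v \<in> set vs. norm v = 1)}"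

definition cliff_in :: "('m, 'i, 'w) spin_data \<Rightarrow> 'i \<Rightarrow> 'm \<Rightarrow> real^5 \<Rightarrow> 'w \<Rightarrow> 'w" where
  "cliff_in M i p X w = clif M (inv (frame M i p) X) w"

text \<open>The equation \<open>s (cliff_in M j p X w) = cliff_in M i p X (s w)\<close> for \<open>s = lift M i j p\<close> says that
  the covering map \<open>Ad : Spin(5) \<longrightarrow> SO(5)\<close> sends \<open>s\<close> to the transition matrix
  \<open>inv (frame M i p) \<circ> frame M j p\<close>.\<close>

definition spin_structure ::
    "('m::topological_space, 'i, 'w::euclidean_space) spin_data \<Rightarrow> bool" where
  "spin_structure M \<longleftrightarrow>
     (\<forall>i. open (cover M i)) \<and> (\<Union>i. cover M i) = UNIV \<and>
     (\<forall>i. \<forall>x. smooth_field_on M (cover M i) (\<lambda>p. frame M i p x)) \<and>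
     (\<forall>i. \<forall>p \<in> cover M i. linear (frame M i p) \<and>
        (\<forall>x y. metric M p (frame M i p x) (frame M i p y) = x \<bullet> y) \<and>
        det (matrix (frame M i p)) > 0) \<and>
     (\<forall>i j w. smooth_map_on M (cover M i \<inter> cover M j) (\<lambda>p. lift M i j p w)) \<and>
     (\<forall>i j. \<forall>p \<in> cover M i \<inter> cover M j. lift M i j p \<in> Spin5 (clif M) \<and>
        (\<forall>X w. lift M i j p (cliff_in M j p X w) = cliff_in M i p X (lift M i j p w))) \<and>
     (\<forall>i j k. \<forall>p \<in> cover M i \<inter> cover M j \<inter> cover M k.
        lift M i j p \<circ> lift M j k p = lift M i k p)"

definition spin_manifold ::
    "('m::{t2_space, second_countable_topology}, 'i, 'w::euclidean_space) spin_data \<Rightarrow> bool" where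
  "spin_manifold M \<longleftrightarrow> oriented_atlas M \<and> riemannian_metric M \<and>
     irreducible_Cl5_module (clif M) \<and> spin_structure M"


section \<open>Spin connection and Dirac operator\<close>

text \<open>\<open>nab p v Y\<close> is the covariant derivative along the tangent vector \<open>v\<close> at \<open>p\<close> of a vector field
  \<open>Y\<close> that is smooth near \<open>p\<close>. Vanishing torsion is expressed by applying
  \<open>\<nabla>\<^sub>X Y - \<nabla>\<^sub>Y X = [X, Y]\<close> to functions.\<close>

definition is_levi_civita :: "('m::topological_space, 'i, 'w) spin_data \<Rightarrow>
    ('m \<Rightarrow> real^5 \<Rightarrow> ('m \<Rightarrow> real^5) \<Rightarrow> real^5) \<Rightarrow> bool" where
  "is_levi_civita M nab \<longleftrightarrow>
     (\<forall>U X Y Z. \<forall>f :: 'm \<Rightarrow> real. open U \<and> smooth_field_on M U X \<and> smooth_field_on M U Y \<and>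
        smooth_field_on M U Z \<and> smooth_map_on M U f \<longrightarrow>
        smooth_field_on M U (\<lambda>p. nab p (X p) Y) \<and>
        (\<forall>p \<in> U.
           linear (\<lambda>v. nab p v Y) \<and>
           (\<forall>v. nab p v (\<lambda>q. Y q + Z q) = nab p v Y + nab p v Z) \<and>
           (\<forall>v. nab p v (\<lambda>q. f q *\<^sub>R Y q) = mderiv M f p v *\<^sub>R Y p + f p *\<^sub>R nab p v Y) \<and>
           (\<forall>v. mderiv M (\<lambda>q. metric M q (Y q) (Z q)) p v =
                  metric M p (nab p v Y) (Z p) + metric M p (Y p) (nab p v Z)) \<and>
           mderiv M f p (nab p (X p) Y - nab p (Y p) X) =
             mderiv M (\<lambda>q. mderiv M f q (Y q)) p (X p) -
             mderiv M (\<lambda>q. mderiv M f q (X q)) p (Y p)))"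

text \<open>The Levi-Civita connection is unique on vector fields that are smooth near the point
  considered; only such arguments occur below.\<close>

definition levi_civita :: "('m::topological_space, 'i, 'w) spin_data \<Rightarrow>
    'm \<Rightarrow> real^5 \<Rightarrow> ('m \<Rightarrow> real^5) \<Rightarrow> real^5" where
  "levi_civita M = (SOME nab. is_levi_civita M nab)"

definition in_triv :: "('m, 'i, 'w) spin_data \<Rightarrow> 'i \<Rightarrow> ('m \<Rightarrow> 'w) \<Rightarrow> 'm \<Rightarrow> 'w" where
  "in_triv M i \<psi> p = lift M i (idx M p) p (\<psi> p)"

definition smooth_spinor_on ::
    "('m, 'i, 'w::euclidean_space) spin_data \<Rightarrow> 'm set \<Rightarrow> ('m \<Rightarrow> 'w) \<Rightarrow> bool" where
  "smooth_spinor_on M U \<psi> \<longleftrightarrow> (\<forall>i. smooth_map_on M (U \<inter> cover M i) (in_triv M i \<psi>))"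

definition cliff :: "('m, 'i, 'w) spin_data \<Rightarrow> 'm \<Rightarrow> real^5 \<Rightarrow> 'w \<Rightarrow> 'w" where
  "cliff M p X w = cliff_in M (idx M p) p X w"

definition onframe :: "('m, 'i, 'w) spin_data \<Rightarrow> 'i \<Rightarrow> 5 \<Rightarrow> 'm \<Rightarrow> real^5" where
  "onframe M i a p = frame M i p (axis a 1)"

text \<open>In a local orthonormal frame, the connection on spinors induced by \<open>\<nabla>\<close> is
  \<open>X(\<psi>) + 1/4 \<Sum>a b. g(\<nabla>\<^sub>X e\<^sub>a, e\<^sub>b) e\<^sub>a e\<^sub>b \<psi>\<close>; the sign is the one for which
  \<open>\<nabla>(Y \<psi>) = (\<nabla> Y) \<psi> + Y \<nabla> \<psi>\<close> under the convention \<open>v \<cdot> v = - |v|^2\<close>.\<close>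

definition spin_nabla ::
    "('m::topological_space, 'i, 'w::euclidean_space) spin_data \<Rightarrow> 'm \<Rightarrow> real^5 \<Rightarrow> ('m \<Rightarrow> 'w) \<Rightarrow> 'w"
  where
  "spin_nabla M p v \<psi> =
     (let i = idx M p; e = onframe M i in
      mderiv M (in_triv M i \<psi>) p v +
      (1 / 4) *\<^sub>R (\<Sum>a\<in>UNIV. \<Sum>b\<in>UNIV. metric M p (levi_civita M p v (e a)) (e b p) *\<^sub>R
         cliff M p (e a p) (cliff M p (e b p) (\<psi> p))))"

definition dirac ::
    "('m::topological_space, 'i, 'w::euclidean_space) spin_data \<Rightarrow> ('m \<Rightarrow> 'w) \<Rightarrow> 'm \<Rightarrow> 'w" where
  "dirac M \<psi> p =
     (let e = onframe M (idx M p) in \<Sum>a\<in>UNIV. cliff M p (e a p) (spin_nabla M p (e a p) \<psi>))"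


section \<open>The operators \<open>\<jmath>\<^sub>k\<close>\<close>

text \<open>In the index type \<open>5\<close> the numeral \<open>5\<close> denotes the same element as \<open>0\<close>.\<close>

definition vol :: "('m, 'i, 'w) spin_data \<Rightarrow> 'm \<Rightarrow> 'w \<Rightarrow> 'w" where
  "vol M p w =
     (let e = (\<lambda>a. cliff M p (onframe M (idx M p) a p)) in e 1 (e 2 (e 3 (e 4 (e 5 w)))))"

definition is_j2 ::
    "('m::topological_space, 'i, 'w::euclidean_space) spin_data \<Rightarrow> ('m \<Rightarrow> 'w \<Rightarrow> 'w) \<Rightarrow> bool" where
  "is_j2 M j2 \<longleftrightarrow>
     (\<forall>p. linear (j2 p) \<and> (\<forall>w. norm (j2 p w) = norm w) \<and> (\<forall>w. j2 p (j2 p w) = - w) \<and>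
        (\<forall>X w. j2 p (cliff M p X w) = - cliff M p X (j2 p w))) \<and>
     (\<forall>U \<psi>. open U \<and> smooth_spinor_on M U \<psi> \<longrightarrow>
        smooth_spinor_on M U (\<lambda>p. j2 p (\<psi> p)) \<and>
        (\<forall>p \<in> U. \<forall>X. spin_nabla M p X (\<lambda>q. j2 q (\<psi> q)) = j2 p (spin_nabla M p X \<psi>)))"

text \<open>Indices \<open>k\<close> below range over \<open>{1..3}\<close>.\<close>

definition jop ::
    "('m, 'i, 'w) spin_data \<Rightarrow> ('m \<Rightarrow> 'w \<Rightarrow> 'w) \<Rightarrow> nat \<Rightarrow> 'm \<Rightarrow> 'w \<Rightarrow> 'w" where
  "jop M j2 k p w = (if k = 1 then vol M p w else if k = 2 then j2 p w else vol M p (j2 p w))"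


section \<open>The \<open>SU(2)\<close> structure of a unit spinor\<close>

definition rank4_subbundle ::
    "('m::topological_space, 'i, 'w) spin_data \<Rightarrow> ('m \<Rightarrow> (real^5) set) \<Rightarrow> bool" where
  "rank4_subbundle M \<xi> \<longleftrightarrow>
     (\<forall>p. subspace (\<xi> p) \<and> dim (\<xi> p) = 4) \<and>
     (\<forall>p. \<exists>U. \<exists>X :: nat \<Rightarrow> 'm \<Rightarrow> real^5. open U \<and> p \<in> U \<and> (\<forall>k<4. smooth_field_on M U (X k)) \<and>
        (\<forall>q \<in> U. \<xi> q = span ((\<lambda>k. X k q) ` {..<4})))"

definition spinor_distribution :: "('m::topological_space, 'i, 'w::euclidean_space) spin_data \<Rightarrow>
    ('m \<Rightarrow> 'w \<Rightarrow> 'w) \<Rightarrow> ('m \<Rightarrow> 'w) \<Rightarrow> ('m \<Rightarrow> (real^5) set) \<Rightarrow> bool" where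
  "spinor_distribution M j2 \<eta> \<xi> \<longleftrightarrow>
     rank4_subbundle M \<xi> \<and>
     (\<forall>p. (\<lambda>X. cliff M p X (\<eta> p)) ` \<xi> p =
        (span {\<eta> p, jop M j2 1 p (\<eta> p), jop M j2 2 p (\<eta> p), jop M j2 3 p (\<eta> p)})\<^sup>\<bottom>)"

definition Jop :: "('m, 'i, 'w) spin_data \<Rightarrow> ('m \<Rightarrow> 'w \<Rightarrow> 'w) \<Rightarrow> ('m \<Rightarrow> 'w) \<Rightarrow>
    ('m \<Rightarrow> (real^5) set) \<Rightarrow> nat \<Rightarrow> 'm \<Rightarrow> real^5 \<Rightarrow> real^5" where
  "Jop M j2 \<eta> \<xi> k p X =
     (THE Y. Y \<in> \<xi> p \<and> cliff M p Y (\<eta> p) = jop M j2 k p (cliff M p X (\<eta> p)))"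

definition proj :: "('m, 'i, 'w) spin_data \<Rightarrow> ('m \<Rightarrow> (real^5) set) \<Rightarrow> 'm \<Rightarrow> real^5 \<Rightarrow> real^5" where
  "proj M \<xi> p X = (THE Y. Y \<in> \<xi> p \<and> (\<forall>Z \<in> \<xi> p. metric M p (X - Y) Z = 0))"

definition omega :: "('m, 'i, 'w) spin_data \<Rightarrow> ('m \<Rightarrow> 'w \<Rightarrow> 'w) \<Rightarrow> ('m \<Rightarrow> 'w) \<Rightarrow>
    ('m \<Rightarrow> (real^5) set) \<Rightarrow> nat \<Rightarrow> 'm \<Rightarrow> real^5 \<Rightarrow> real^5 \<Rightarrow> real" where
  "omega M j2 \<eta> \<xi> k p X Y =
     metric M p (Jop M j2 \<eta> \<xi> k p (proj M \<xi> p X)) (proj M \<xi> p Y)"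

definition wedge_square :: "('a \<Rightarrow> 'a \<Rightarrow> real) \<Rightarrow> 'a \<Rightarrow> 'a \<Rightarrow> 'a \<Rightarrow> 'a \<Rightarrow> real" where
  "wedge_square \<omega> a b c d = 2 * (\<omega> a b * \<omega> c d - \<omega> a c * \<omega> b d + \<omega> a d * \<omega> b c)"

text \<open>The last condition is \<open>TM = \<xi> \<oplus> \<langle>R\<rangle>\<close> as oriented bundles: a quadruple in \<open>\<xi>\<close> is a positive basis
  for the orientation given by \<open>\<omega>\<^sub>1\<^sup>2\<close> iff followed by \<open>R\<close> it is a positive basis of the tangent
  space.\<close>

definition unit_normal_field :: "('m::topological_space, 'i, 'w) spin_data \<Rightarrow>
    ('m \<Rightarrow> 'w \<Rightarrow> 'w) \<Rightarrow> ('m \<Rightarrow> 'w) \<Rightarrow> ('m \<Rightarrow> (real^5) set) \<Rightarrow> ('m \<Rightarrow> real^5) \<Rightarrow> bool" where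
  "unit_normal_field M j2 \<eta> \<xi> R \<longleftrightarrow>
     smooth_field_on M UNIV R \<and>
     (\<forall>p. metric M p (R p) (R p) = 1 \<and> (\<forall>X \<in> \<xi> p. metric M p (R p) X = 0) \<and>
        (\<forall>a \<in> \<xi> p. \<forall>b \<in> \<xi> p. \<forall>c \<in> \<xi> p. \<forall>d \<in> \<xi> p.
           wedge_square (omega M j2 \<eta> \<xi> 1 p) a b c d > 0 \<longleftrightarrow>
           det (vector [a, b, c, d, R p] :: real^5^5) > 0))"


section \<open>Decomposition of \<open>\<nabla>\<eta>\<close>\<close>

text \<open>Endomorphisms of \<open>\<xi>\<close> and 1-forms on \<open>\<xi>\<close> are represented by functions on the tangent spaces whose
  values outside \<open>\<xi>\<close> are irrelevant.\<close>

definition linear_within :: "'a::real_vector set \<Rightarrow> ('a \<Rightarrow> 'b::real_vector) \<Rightarrow> bool" where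
  "linear_within L T \<longleftrightarrow>
     (\<forall>x \<in> L. \<forall>y \<in> L. T (x + y) = T x + T y) \<and> (\<forall>c. \<forall>x \<in> L. T (c *\<^sub>R x) = c *\<^sub>R T x)"

definition endo_section :: "('m::topological_space, 'i, 'w) spin_data \<Rightarrow> ('m \<Rightarrow> (real^5) set) \<Rightarrow>
    ('m \<Rightarrow> real^5 \<Rightarrow> real^5) \<Rightarrow> bool" where
  "endo_section M \<xi> T \<longleftrightarrow>
     (\<forall>p. linear_within (\<xi> p) (T p) \<and> T p ` \<xi> p \<subseteq> \<xi> p) \<and>
     (\<forall>U X. open U \<and> smooth_field_on M U X \<and> (\<forall>p \<in> U. X p \<in> \<xi> p) \<longrightarrow>
        smooth_field_on M U (\<lambda>p. T p (X p)))"

definition form_section :: "('m::topological_space, 'i, 'w) spin_data \<Rightarrow> ('m \<Rightarrow> (real^5) set) \<Rightarrow>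
    ('m \<Rightarrow> real^5 \<Rightarrow> real) \<Rightarrow> bool" where
  "form_section M \<xi> \<theta> \<longleftrightarrow>
     (\<forall>p. linear_within (\<xi> p) (\<theta> p)) \<and>
     (\<forall>U X. open U \<and> smooth_field_on M U X \<and> (\<forall>p \<in> U. X p \<in> \<xi> p) \<longrightarrow>
        smooth_map_on M U (\<lambda>p. \<theta> p (X p)))"

definition sharp :: "('m, 'i, 'w) spin_data \<Rightarrow> ('m \<Rightarrow> (real^5) set) \<Rightarrow>
    ('m \<Rightarrow> real^5 \<Rightarrow> real) \<Rightarrow> 'm \<Rightarrow> real^5" where
  "sharp M \<xi> \<theta> p = (THE Y. Y \<in> \<xi> p \<and> (\<forall>X \<in> \<xi> p. metric M p Y X = \<theta> p X))"

definition nabla_decomposition :: "('m::topological_space, 'i, 'w::euclidean_space) spin_data \<Rightarrow>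
    ('m \<Rightarrow> 'w \<Rightarrow> 'w) \<Rightarrow> ('m \<Rightarrow> 'w) \<Rightarrow> ('m \<Rightarrow> (real^5) set) \<Rightarrow> ('m \<Rightarrow> real^5) \<Rightarrow>
    ('m \<Rightarrow> real^5 \<Rightarrow> real^5) \<Rightarrow> ('m \<Rightarrow> real^5) \<Rightarrow> (nat \<Rightarrow> 'm \<Rightarrow> real^5 \<Rightarrow> real) \<Rightarrow>
    (nat \<Rightarrow> 'm \<Rightarrow> real) \<Rightarrow> bool" where
  "nabla_decomposition M j2 \<eta> \<xi> R S V \<Theta> \<phi> \<longleftrightarrow>
     endo_section M \<xi> S \<and>
     smooth_field_on M UNIV V \<and> (\<forall>p. V p \<in> \<xi> p) \<and>
     (\<forall>l \<in> {1..3}. form_section M \<xi> (\<Theta> l) \<and> smooth_map_on M UNIV (\<phi> l)) \<and>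
     (\<forall>p X. let X\<^sub>\<xi> = proj M \<xi> p X; \<alpha>X = metric M p (R p) X in
        spin_nabla M p X \<eta> =
          cliff M p (S p X\<^sub>\<xi>) (\<eta> p) + \<alpha>X *\<^sub>R cliff M p (V p) (\<eta> p) +
          (\<Sum>l\<in>{1..3}. (\<Theta> l p X\<^sub>\<xi> + \<alpha>X * \<phi> l p) *\<^sub>R jop M j2 l p (\<eta> p)))"

definition symmetric_within :: "(real^5 \<Rightarrow> real^5 \<Rightarrow> real) \<Rightarrow> (real^5) set \<Rightarrow>
    (real^5 \<Rightarrow> real^5) \<Rightarrow> bool" where
  "symmetric_within g L T \<longleftrightarrow> (\<forall>X \<in> L. \<forall>Y \<in> L. g (T X) Y = g X (T Y))"

definition skew_within :: "(real^5 \<Rightarrow> real^5 \<Rightarrow> real) \<Rightarrow> (real^5) set \<Rightarrow>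
    (real^5 \<Rightarrow> real^5) \<Rightarrow> bool" where
  "skew_within g L T \<longleftrightarrow> (\<forall>X \<in> L. \<forall>Y \<in> L. g (T X) Y = - g X (T Y))"

definition traceless_within :: "(real^5 \<Rightarrow> real^5 \<Rightarrow> real) \<Rightarrow> (real^5) set \<Rightarrow>
    (real^5 \<Rightarrow> real^5) \<Rightarrow> bool" where
  "traceless_within g L T \<longleftrightarrow>
     (\<forall>B. B \<subseteq> L \<and> span B = L \<and> (\<forall>x \<in> B. \<forall>y \<in> B. g x y = (if x = y then 1 else 0)) \<longrightarrow>
        (\<Sum>x\<in>B. g (T x) x) = 0)"

definition endo_decomposition :: "('m::topological_space, 'i, 'w) spin_data \<Rightarrow>
    ('m \<Rightarrow> 'w \<Rightarrow> 'w) \<Rightarrow> ('m \<Rightarrow> 'w) \<Rightarrow> ('m \<Rightarrow> (real^5) set) \<Rightarrow> ('m \<Rightarrow> real^5 \<Rightarrow> real^5) \<Rightarrow>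
    ('m \<Rightarrow> real) \<Rightarrow> (nat \<Rightarrow> 'm \<Rightarrow> real) \<Rightarrow> (nat \<Rightarrow> 'm \<Rightarrow> real^5 \<Rightarrow> real^5) \<Rightarrow>
    ('m \<Rightarrow> real^5 \<Rightarrow> real^5) \<Rightarrow> bool" where
  "endo_decomposition M j2 \<eta> \<xi> S \<mu> lam Sl S0 \<longleftrightarrow>
     smooth_map_on M UNIV \<mu> \<and> (\<forall>l \<in> {1..3}. smooth_map_on M UNIV (lam l)) \<and>
     (\<forall>k \<in> {1..3}. endo_section M \<xi> (Sl k)) \<and> endo_section M \<xi> S0 \<and>
     (\<forall>p. \<forall>X \<in> \<xi> p. S p X =
        \<mu> p *\<^sub>R X + (\<Sum>l\<in>{1..3}. Sl l p X) + (\<Sum>l\<in>{1..3}. lam l p *\<^sub>R Jop M j2 \<eta> \<xi> l p X) + S0 p X) \<and>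
     (\<forall>p. \<forall>k \<in> {1..3}.
        symmetric_within (metric M p) (\<xi> p) (Sl k p) \<and>
        traceless_within (metric M p) (\<xi> p) (Sl k p) \<and>
        (\<forall>X \<in> \<xi> p. Sl k p (Jop M j2 \<eta> \<xi> k p X) = Jop M j2 \<eta> \<xi> k p (Sl k p X)) \<and>
        (\<forall>l \<in> {1..3} - {k}. \<forall>X \<in> \<xi> p.
           Sl k p (Jop M j2 \<eta> \<xi> l p X) = - Jop M j2 \<eta> \<xi> l p (Sl k p X))) \<and>
     (\<forall>p. skew_within (metric M p) (\<xi> p) (S0 p) \<and>
        (\<forall>l \<in> {1..3}. \<forall>X \<in> \<xi> p. S0 p (Jop M j2 \<eta> \<xi> l p X) = Jop M j2 \<eta> \<xi> l p (S0 p X)))"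

end

theory Submission
  imports Defs
begin

text \<open>Everything happens at one point. Choose a unit vector \<open>b\<close> in \<open>\<xi>\<close>; then \<open>b\<close>, \<open>J\<^sub>1 b\<close>, \<open>J\<^sub>2 b\<close>, \<open>J\<^sub>3 b\<close>, \<open>R\<close>
  is a positive orthonormal basis, in which the Clifford trace defining \<open>D\<eta>\<close> may be computed. Since
  the volume form is the product of any positive orthonormal basis, \<open>R \<eta> = - \<jmath>\<^sub>1 \<eta>\<close>, which gives the terms
  in \<open>V\<close> and \<open>\<phi>\<^sub>l\<close>. For an endomorphism \<open>T\<close> of \<open>\<xi>\<close>, the sum of \<open>e\<^sub>i T(e\<^sub>i) \<eta>\<close> is \<open>- (tr T) \<eta>\<close> if \<open>T\<close> is symmetric,
  vanishes if \<open>T\<close> is skew and commutes with the \<open>J\<^sub>l\<close>, and is a multiple of \<open>\<jmath>\<^sub>l \<eta>\<close> if \<open>T = J\<^sub>l\<close>.\<close>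

section \<open>Clifford multiplication and orthonormal bases\<close>

lemma exhaust_5:
  fixes x :: 5
  shows "x = 1 \<or> x = 2 \<or> x = 3 \<or> x = 4 \<or> x = 5"
proof (induct x)
  case (of_int z)
  then have "z = 0 \<or> z = 1 \<or> z = 2 \<or> z = 3 \<or> z = 4" by fastforce
  then show ?case by auto
qed

lemma forall_5: "(\<forall>i::5. P i) \<longleftrightarrow> P 1 \<and> P 2 \<and> P 3 \<and> P 4 \<and> P 5"
  by (metis exhaust_5)

lemma vector_5 [simp]:
  fixes a :: "'a::zero"
  shows "(vector [a, b, c, d, e] :: 'a^5) $ 1 = a" "(vector [a, b, c, d, e] :: 'a^5) $ 2 = b"
    "(vector [a, b, c, d, e] :: 'a^5) $ 3 = c" "(vector [a, b, c, d, e] :: 'a^5) $ 4 = d"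
    "(vector [a, b, c, d, e] :: 'a^5) $ 5 = e"
  by (simp_all add: vector_def)

text \<open>The form \<open>g\<close> is kept apart from the inner product of the type, since the
  setting is used twice: for \<open>real^5\<close> with its standard product, and for the tangent
  space at \<open>p\<close> with \<open>metric M p\<close>.\<close>

locale clifford_action =
  fixes g :: "'v::euclidean_space \<Rightarrow> 'v \<Rightarrow> real" and c :: "'v \<Rightarrow> 'w::real_inner \<Rightarrow> 'w"
  assumes bilinear_g: "bilinear g" and g_sym: "g x y = g y x"
    and g_pos: "x \<noteq> 0 \<Longrightarrow> g x x > 0"
    and bilinear_c: "bilinear c" and c_sq: "c v (c v w) = - (g v v *\<^sub>R w)"
    and c_skew: "c v w \<bullet> w' = - (w \<bullet> c v w')"
begin

lemmas g_simps = bilinear_ladd[OF bilinear_g] bilinear_radd[OF bilinear_g]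
  bilinear_lsub[OF bilinear_g] bilinear_rsub[OF bilinear_g]
  bilinear_lmul[OF bilinear_g, unfolded real_scaleR_def]
  bilinear_rmul[OF bilinear_g, unfolded real_scaleR_def]
  bilinear_lneg[OF bilinear_g] bilinear_rneg[OF bilinear_g]
  bilinear_lzero[OF bilinear_g] bilinear_rzero[OF bilinear_g]

lemmas c_simps = bilinear_ladd[OF bilinear_c] bilinear_radd[OF bilinear_c]
  bilinear_lsub[OF bilinear_c] bilinear_rsub[OF bilinear_c]
  bilinear_lmul[OF bilinear_c] bilinear_rmul[OF bilinear_c]
  bilinear_lneg[OF bilinear_c] bilinear_rneg[OF bilinear_c]
  bilinear_lzero[OF bilinear_c] bilinear_rzero[OF bilinear_c]

lemma linear_c: "linear (c v)" and linear_c_left: "linear (\<lambda>v. c v w)"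
  and linear_g: "linear (g x)" and linear_g_left: "linear (\<lambda>x. g x y)"
  using bilinear_c bilinear_g by (auto simp: bilinear_def)

lemmas c_sum = linear_sum[OF linear_c] linear_sum[OF linear_c_left]
lemmas g_sum = linear_sum[OF linear_g] linear_sum[OF linear_g_left]

text \<open>Polarization of \<open>c_sq\<close> at \<open>u + v\<close>.\<close>

lemma c_anticomm: "c u (c v w) = - c v (c u w) - (2 * g u v) *\<^sub>R w"
proof -
  have "c (u + v) (c (u + v) w) = - (g (u + v) (u + v) *\<^sub>R w)" by (rule c_sq)
  then have "c u (c v w) + c v (c u w) + (g u v + g v u) *\<^sub>R w = 0"
    by (simp add: c_simps g_simps c_sq algebra_simps)
  then show ?thesis
    by (simp add: g_sym[of v u] algebra_simps add_eq_0_iff2 flip: mult_2)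
qed

text \<open>Skewness and anticommutation turn the right side into its own negative plus twice the
  left side. For a unit spinor, Clifford multiplication is thus an isometry into the
  spinors.\<close>

lemma g_inner: "g u v * (w \<bullet> w) = c u w \<bullet> c v w"
proof -
  have "c u w \<bullet> c v w = - (w \<bullet> c u (c v w))" by (rule c_skew)
  also have "\<dots> = w \<bullet> c v (c u w) + 2 * g u v * (w \<bullet> w)"
    by (subst c_anticomm) (simp add: inner_simps)
  also have "w \<bullet> c v (c u w) = - (c u w \<bullet> c v w)"
    by (metis c_skew inner_commute)
  finally show ?thesis by (simp add: inner_commute)
qed

lemma c_eq_0: "c v w = 0 \<Longrightarrow> w \<noteq> 0 \<Longrightarrow> v = 0"
  using c_sq[of v w] g_pos[of v] by (auto simp: c_simps)

text \<open>Indexed families cover both the frame, indexed by the type \<open>5\<close>, and bases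
  of \<xi>, indexed by \<open>{..3}\<close>.\<close>

definition ortho :: "'k set \<Rightarrow> ('k \<Rightarrow> 'v) \<Rightarrow> bool" where
  "ortho I u \<longleftrightarrow> (\<forall>i\<in>I. \<forall>k\<in>I. g (u i) (u k) = (if i = k then 1 else 0))"

lemma ortho_coeff:
  assumes "ortho I u" "finite I" "i \<in> I"
  shows "g (\<Sum>k\<in>I. a k *\<^sub>R u k) (u i) = a i"
proof -
  have "g (\<Sum>k\<in>I. a k *\<^sub>R u k) (u i) = (\<Sum>k\<in>I. if k = i then a k else 0)"
    unfolding g_sum g_simps using assms by (intro sum.cong) (auto simp: ortho_def)
  then show ?thesis using assms by simp
qed

lemma ortho_inj_on: assumes "ortho I u" shows "inj_on u I"
proof (rule inj_onI)
  fix i k assume *: "i \<in> I" "k \<in> I" "u i = u k"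
  have "g (u i) (u i) = 1" "g (u i) (u k) = (if i = k then 1 else 0)"
    using assms *(1,2) unfolding ortho_def by simp_all
  then show "i = k" using *(3) by (simp split: if_splits)
qed

lemma ortho_span:
  assumes u: "ortho I u" and fin: "finite I" and L: "u ` I \<subseteq> L" "dim L = card I" "x \<in> L"
  shows "x = (\<Sum>k\<in>I. g x (u k) *\<^sub>R u k)" "x \<in> span (u ` I)"
proof -
  have "independent (u ` I)"
  proof (rule independent_if_scalars_zero)
    fix f y assume 0: "(\<Sum>z\<in>u ` I. f z *\<^sub>R z) = 0" and "y \<in> u ` I"
    then obtain i where i: "i \<in> I" "y = u i" by auto
    have "(\<Sum>k\<in>I. f (u k) *\<^sub>R u k) = 0"
      using 0 by (simp add: sum.reindex[OF ortho_inj_on[OF u]])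
    then show "f y = 0"
      using ortho_coeff[OF u fin i(1), of "\<lambda>k. f (u k)"] i by (simp add: g_simps)
  qed (use fin in simp)
  then have "L \<subseteq> span (u ` I)"
    using L card_image[OF ortho_inj_on[OF u]] by (intro card_ge_dim_independent) auto
  then show "x \<in> span (u ` I)" using L by auto
  then obtain f where "x = (\<Sum>z\<in>u ` I. f z *\<^sub>R z)"
    using fin by (auto simp: span_finite)
  then have x: "x = (\<Sum>k\<in>I. f (u k) *\<^sub>R u k)"
    by (simp add: sum.reindex[OF ortho_inj_on[OF u]])
  then have "g x (u k) = f (u k)" if "k \<in> I" for k
    using ortho_coeff[OF u fin that] by simp
  then show "x = (\<Sum>k\<in>I. g x (u k) *\<^sub>R u k)" using x by simp
qed

text \<open>The trace is a contraction: once the sums are exchanged, the coefficients along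
  \<open>e\<close> reassemble each \<open>u i\<close>. Here \<open>G i\<close> plays the part of
  \<open>F (u i)\<close>.\<close>

lemma c_trace_frame_change:
  assumes e: "ortho (UNIV :: 'k::finite set) e" and card: "CARD('k) = DIM('v)"
    and F: "\<And>x. F x = (\<Sum>i\<in>I. g x (u i) *\<^sub>R G i)"
  shows "(\<Sum>a\<in>UNIV. c (e a) (F (e a))) = (\<Sum>i\<in>I. c (u i) (G i))"
proof -
  have "(\<Sum>a\<in>UNIV. c (e a) (F (e a))) = (\<Sum>a\<in>UNIV. \<Sum>i\<in>I. c (g (u i) (e a) *\<^sub>R e a) (G i))"
    by (simp add: F c_sum c_simps g_sym)
  also have "\<dots> = (\<Sum>i\<in>I. c (\<Sum>a\<in>UNIV. g (u i) (e a) *\<^sub>R e a) (G i))"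
    by (subst sum.swap) (simp add: c_sum)
  finally show ?thesis
    using ortho_span(1)[OF e, of UNIV] card by simp
qed

text \<open>Expanding \<open>T (u i)\<close> gives a double sum of Clifford products with symmetric
  coefficients; \<open>c_anticomm\<close> reduces such a sum to its diagonal.\<close>

lemma c_trace_symmetric:
  assumes u: "ortho I u" and fin: "finite I" and L: "u ` I \<subseteq> L" "dim L = card I"
    and T: "T ` L \<subseteq> L" and sym: "\<And>x y. x \<in> L \<Longrightarrow> y \<in> L \<Longrightarrow> g (T x) y = g x (T y)"
  shows "(\<Sum>i\<in>I. c (u i) (c (T (u i)) w)) = - (\<Sum>i\<in>I. g (T (u i)) (u i)) *\<^sub>R w"
proof -
  let ?s = "\<Sum>i\<in>I. \<Sum>k\<in>I. g (T (u i)) (u k) *\<^sub>R c (u i) (c (u k) w)"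
  have *: "c (u i) (c (T (u i)) w) = (\<Sum>k\<in>I. g (T (u i)) (u k) *\<^sub>R c (u i) (c (u k) w))" if "i \<in> I" for i
    using that L T by (subst ortho_span(1)[OF u fin L, of "T (u i)"]) (auto simp: c_sum c_simps)
  \<comment> \<open>Exchanging the two indices and using the symmetry of \<open>T\<close> reverses
    the order of the two Clifford factors.\<close>
  have "?s = (\<Sum>i\<in>I. \<Sum>k\<in>I. g (T (u i)) (u k) *\<^sub>R c (u k) (c (u i) w))"
  proof (subst sum.swap, intro sum.cong refl)
    fix i k assume "i \<in> I" "k \<in> I"
    then show "g (T (u k)) (u i) *\<^sub>R c (u k) (c (u i) w) = g (T (u i)) (u k) *\<^sub>R c (u k) (c (u i) w)"
      using sym[of "u k" "u i"] L g_sym by auto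
  qed
  also have "\<dots> = - ?s - (\<Sum>i\<in>I. \<Sum>k\<in>I. (g (T (u i)) (u k) * (2 * g (u k) (u i))) *\<^sub>R w)"
    by (subst c_anticomm) (simp add: algebra_simps sum_subtractf sum_negf)
  also have "(\<Sum>i\<in>I. \<Sum>k\<in>I. (g (T (u i)) (u k) * (2 * g (u k) (u i))) *\<^sub>R w)
      = (\<Sum>i\<in>I. \<Sum>k\<in>I. if k = i then (2 * g (T (u i)) (u i)) *\<^sub>R w else 0)"
    using u by (intro sum.cong refl) (auto simp: ortho_def)
  also have "\<dots> = 2 *\<^sub>R (\<Sum>i\<in>I. g (T (u i)) (u i)) *\<^sub>R w"
    using fin by (simp add: scaleR_sum_left scaleR_right.sum)
  finally have "?s + ?s = (- ?s - 2 *\<^sub>R (\<Sum>i\<in>I. g (T (u i)) (u i)) *\<^sub>R w) + ?s"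
    by (rule arg_cong)
  then have "2 *\<^sub>R ?s = 2 *\<^sub>R (- (\<Sum>i\<in>I. g (T (u i)) (u i)) *\<^sub>R w)"
    by (simp add: scaleR_2)
  then show ?thesis
    using * by (simp only: scaleR_cancel_left) simp
qed

end

text \<open>All signs are parities: a factor passes the four others with an even number of sign
  changes, reversing five factors takes ten transpositions, and the product times its reversal
  collapses to (-1)^5.\<close>

lemma five_anticommuting:
  fixes A :: "5 \<Rightarrow> 'w::real_vector \<Rightarrow> 'w"
  assumes sq: "\<And>i w. A i (A i w) = - w" and neg: "\<And>i w. A i (- w) = - A i w"
    and ac: "\<And>i k w. i \<noteq> k \<Longrightarrow> A i (A k w) = - A k (A i w)"
  defines "P \<equiv> \<lambda>w. A 1 (A 2 (A 3 (A 4 (A 5 w))))"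
  shows "P (P w) = - w" "A i (P w) = P (A i w)"
    "A 5 (A 4 (A 3 (A 2 (A 1 w)))) = P w"
proof -
  \<comment> \<open>Every instance moves the smaller index to the left, so rewriting sorts a word by
    index and then cancels equal neighbours.\<close>
  note r = ac[of 2 1] ac[of 3 1] ac[of 4 1] ac[of 5 1] ac[of 3 2] ac[of 4 2] ac[of 5 2]
    ac[of 4 3] ac[of 5 3] ac[of 5 4]
  have d: "(5::5) \<noteq> 1" "(5::5) \<noteq> 2" "(5::5) \<noteq> 3" "(5::5) \<noteq> 4" "(4::5) \<noteq> 1" by simp_all
  show "P (P w) = - w" "A 5 (A 4 (A 3 (A 2 (A 1 w)))) = P w"
    unfolding P_def by (simp_all add: r sq neg)
  show "A i (P w) = P (A i w)"
    unfolding P_def using exhaust_5[of i] by (elim disjE) (simp_all add: r sq neg)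
qed

section \<open>The volume element\<close>

text \<open>The reflection is a diagonal matrix with one entry -1, conjugated by an orthogonal
  matrix that takes a coordinate vector to \<open>n\<close>. It is described on row vectors because
  \<open>A ** H\<close> reflects the rows of \<open>A\<close>.\<close>

lemma exists_reflection_matrix:
  fixes n :: "real^'n"
  assumes n: "norm n = 1"
  obtains H :: "real^'n^'n" where "det H = - 1" "orthogonal_matrix H"
    "\<And>x. x v* H = x - (2 * (x \<bullet> n)) *\<^sub>R n"
proof -
  obtain Q :: "real^'n^'n" and k where Q: "orthogonal_matrix Q" "Q *v axis k 1 = n"
    using orthogonal_matrix_exists_basis[OF n] by metis
  define D :: "real^'n^'n" where "D = (\<chi> i j. if i = j then (if i = k then - 1 else 1) else 0)"
  define H where "H = Q ** D ** transpose Q"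
  have detD: "det D = - 1"
    by (subst det_diagonal) (auto simp: D_def prod.If_cases)
  have "det Q * det Q = 1"
    using det_orthogonal_matrix[OF Q(1)] by auto
  then have "det H = - 1"
    by (simp add: H_def det_mul detD)
  moreover have "orthogonal_matrix H"
  proof -
    have "(\<Sum>l\<in>UNIV. D $ l $ i * D $ l $ j) = (\<Sum>l\<in>UNIV. if l = i then (if i = j then 1 else 0) else 0)" for i j
      by (intro sum.cong) (auto simp: D_def)
    then have "transpose D ** D = mat 1"
      by (simp add: transpose_def matrix_matrix_mult_def mat_def vec_eq_iff)
    then have "orthogonal_matrix D" by (simp add: orthogonal_matrix)
    then show ?thesis
      using Q unfolding H_def by (intro orthogonal_matrix_mul) auto
  qed
  moreover have "x v* H = x - (2 * (x \<bullet> n)) *\<^sub>R n" for x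
  proof -
    let ?y = "x v* Q"
    have nk: "n = column k Q" using Q by (simp add: matrix_vector_mult_basis)
    have yk: "?y $ k = x \<bullet> n"
      by (simp add: nk vector_matrix_mult_def column_def inner_vec_def mult.commute)
    have yD: "y v* D = y - (2 * (y $ k)) *\<^sub>R axis k 1" for y
    proof -
      have "(\<Sum>i\<in>UNIV. y $ i * D $ i $ j) = (\<Sum>i\<in>UNIV. if i = j then y $ j * D $ j $ j else 0)" for j
        by (intro sum.cong) (auto simp: D_def)
      then have "(\<Sum>i\<in>UNIV. y $ i * D $ i $ j) = y $ j * D $ j $ j" for j by simp
      then show ?thesis
        by (auto simp: vec_eq_iff vector_matrix_mult_def axis_def D_def)
    qed
    have "x v* H = ?y v* D v* transpose Q"
      by (simp only: H_def vector_matrix_mul_assoc)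
    also have "\<dots> = ?y v* transpose Q - (2 * (x \<bullet> n)) *\<^sub>R (axis k 1 v* transpose Q)"
      by (simp add: yD yk vector_transpose_matrix matrix_vector_mult_diff_distrib matrix_vector_mult_scaleR)
    also have "?y v* transpose Q = x"
      using Q(1) by (simp only: vector_matrix_mul_assoc orthogonal_matrix_def vector_matrix_mul_rid)
    also have "axis k 1 v* transpose Q = n"
      using Q(2) by (simp add: vector_transpose_matrix)
    finally show ?thesis .
  qed
  ultimately show thesis by (rule that)
qed

text \<open>Householder reflections move the rows one by one to the standard basis. Each reflection along
  a unit vector \<open>n\<close> is \<open>v \<mapsto> n v n\<close>, so it conjugates the product by \<open>n\<close> and changes its sign just as
  it changes the sign of the determinant.\<close>

lemma clifford_product_orthogonal:
  fixes c :: "real^5 \<Rightarrow> 'w::real_inner \<Rightarrow> 'w" and A :: "real^5^5"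
  assumes "clifford_action (\<bullet>) c" and A: "orthogonal_matrix A"
  defines "P \<equiv> \<lambda>A w. c (A $ 1) (c (A $ 2) (c (A $ 3) (c (A $ 4) (c (A $ 5) w))))"
  shows "P A w = det A *\<^sub>R P (mat 1) w"
proof -
  interpret clifford_action "(\<bullet>)" c by fact
  have orth: "A $ i \<bullet> A $ k = (if i = k then 1 else 0)" if "orthogonal_matrix A" for A :: "real^5^5" and i k
    using that by (auto simp: orthogonal_matrix_orthonormal_rows row_def orthogonal_def norm_eq_1)
  \<comment> \<open>A product of five orthonormal vectors commutes with each of them, and these span
    the space.\<close>
  have comm: "c v (P A w) = P A (c v w)" if A: "orthogonal_matrix A" for A v w
  proof -
    have o: "ortho UNIV (($) A)" using orth[OF A] by (simp add: ortho_def)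
    have "v = (\<Sum>k\<in>UNIV. (v \<bullet> A $ k) *\<^sub>R A $ k)"
      by (rule ortho_span(1)[OF o, of UNIV]) auto
    then have "c v x = c (\<Sum>k\<in>UNIV. (v \<bullet> A $ k) *\<^sub>R A $ k) x" for x
      by (rule arg_cong)
    then have v: "c v x = (\<Sum>k\<in>UNIV. (v \<bullet> A $ k) *\<^sub>R c (A $ k) x)" for x
      by (simp only: c_sum c_simps)
    have comm: "c (A $ i) (P A w) = P A (c (A $ i) w)" for i
      unfolding P_def
    proof (rule five_anticommuting(2))
      show "c (A $ j) (c (A $ k) w) = - c (A $ k) (c (A $ j) w)" if "j \<noteq> k" for j k w
        using that by (subst c_anticomm) (simp add: orth[OF A])
    qed (simp_all add: c_sq orth[OF A] c_simps)
    have "linear (P A)"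
      unfolding P_def by (intro linearI) (simp_all add: c_simps)
    then show ?thesis
      by (simp only: v comm linear_sum linear_scale)
  qed
  have refl: "P (A ** H) w = - P A w"
    if A: "orthogonal_matrix A" and n: "norm n = 1" and H: "\<And>x. x v* H = x - (2 * (x \<bullet> n)) *\<^sub>R n"
    for A :: "real^5^5" and H n w
  proof -
    have nn: "c n (c n x) = - x" for x
      using n by (simp add: c_sq norm_eq_1)
    \<comment> \<open>By anticommutation and \<open>n n = -1\<close>, the product
      \<open>n v n\<close> is \<open>v - 2 (v \<bullet> n) n\<close>.\<close>
    have row: "c ((A ** H) $ i) x = c n (c (A $ i) (c n x))" for i x
    proof -
      have "(A ** H) $ i = A $ i - (2 * (A $ i \<bullet> n)) *\<^sub>R n"
        using H[of "A $ i"] by (simp add: vec_eq_iff matrix_matrix_mult_def vector_matrix_mult_def mult.commute)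
      then show ?thesis
        by (simp add: c_anticomm[of n "A $ i"] nn c_simps inner_commute)
    qed
    \<comment> \<open>The four inner pairs \<open>n n\<close> contribute (-1)^4; the two outer
      factors \<open>n\<close> remain, and commuting them together gives the final sign.\<close>
    have "P (A ** H) w = c n (P A (c n w))"
      by (simp add: P_def row nn c_simps)
    then show ?thesis by (simp add: comm[OF A, symmetric] nn)
  qed
  \<comment> \<open>Induction on the number of rows that differ from the standard basis.\<close>
  have "P A w = det A *\<^sub>R P (mat 1) w" if "orthogonal_matrix A" for A
    using that
  proof (induction "card {i. A $ i \<noteq> axis i 1}" arbitrary: A rule: less_induct)
    case (less A)
    show ?case
    proof (cases "\<forall>i. A $ i = axis i 1")
      case True
      then have "A = mat 1" by (simp add: vec_eq_iff mat_def axis_def)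
      then show ?thesis by simp
    next
      case False
      then obtain i where i: "A $ i \<noteq> axis i 1" by auto
      \<comment> \<open>Reflecting along \<open>d\<close> takes the unit vector \<open>A $ i\<close>
        to the unit vector \<open>axis i 1\<close>.\<close>
      define d where "d = A $ i - axis i 1"
      define n where "n = d /\<^sub>R norm d"
      have d: "d \<noteq> 0" "norm d \<noteq> 0" using i by (auto simp: d_def)
      have n: "norm n = 1" using d by (simp add: n_def)
      obtain H where H: "det H = - 1" "orthogonal_matrix H"
        "\<And>x. x v* H = x - (2 * (x \<bullet> n)) *\<^sub>R n"
        using exists_reflection_matrix[OF n] by blast
      have AH: "orthogonal_matrix (A ** H)" using less.prems H(2) by (rule orthogonal_matrix_mul)
      have row: "(A ** H) $ k = A $ k - (2 * (A $ k \<bullet> n)) *\<^sub>R n" for k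
        using H(3)[of "A $ k"] by (simp add: vec_eq_iff matrix_matrix_mult_def vector_matrix_mult_def mult.commute)
      \<comment> \<open>Both vectors have length 1, so the squared length of their difference is
        twice \<open>A $ i \<bullet> d\<close>; the reflection therefore subtracts exactly
        \<open>d\<close> from row \<open>i\<close>.\<close>
      have dd: "norm d * norm d = 2 * (A $ i \<bullet> d)"
        unfolding d_def
        by (simp flip: power2_eq_square add: power2_norm_eq_inner inner_diff_left inner_diff_right
            orth[OF less.prems] inner_axis_axis inner_commute[of "axis i 1"])
      have "(2 * (A $ i \<bullet> n)) *\<^sub>R n = (norm d * norm d / (norm d * norm d)) *\<^sub>R d"
        by (subst (1) dd) (simp add: n_def divide_inverse mult_ac)
      then have "(2 * (A $ i \<bullet> n)) *\<^sub>R n = d"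
        using d(2) by simp
      then have rowi: "(A ** H) $ i = axis i 1" by (simp add: row d_def)
      \<comment> \<open>A row that is already standard is orthogonal to \<open>A $ i\<close> and to
        \<open>axis i 1\<close>, hence to \<open>d\<close>, and stays fixed.\<close>
      have "(A ** H) $ k = axis k 1" if k: "A $ k = axis k 1" for k
      proof -
        have "k \<noteq> i" using i k by auto
        then have "A $ k \<bullet> d = 0"
          using orth[OF less.prems, of k i] k by (simp add: d_def inner_diff_right inner_axis_axis)
        then show ?thesis using k by (simp add: row n_def)
      qed
      with rowi i have "{k. (A ** H) $ k \<noteq> axis k 1} \<subset> {k. A $ k \<noteq> axis k 1}" by auto
      then have "card {k. (A ** H) $ k \<noteq> axis k 1} < card {k. A $ k \<noteq> axis k 1}"
        by (intro psubset_card_mono) auto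
      from less.hyps[OF this AH] have "P (A ** H) w = - det A *\<^sub>R P (mat 1) w"
        by (simp add: det_mul H(1))
      then show ?thesis using refl[OF less.prems n H(3), of w] by simp
    qed
  qed
  then show ?thesis using A .
qed

section \<open>The \<open>SU(2)\<close> structure of a unit spinor at a point\<close>

declare One_nat_def [simp del]

lemma one_to_three: "k \<in> {1..3::nat} \<longleftrightarrow> k = 1 \<or> k = 2 \<or> k = 3"
  by auto

lemma sum_one_to_three: "(\<Sum>k\<in>{1..3::nat}. f k) = f 1 + f 2 + (f 3 :: 'a::comm_monoid_add)"
  by (simp add: numeral_eq_Suc One_nat_def add.assoc)

lemma atMost_three: "{..3::nat} = {0, 1, 2, 3}"
  by auto

lemma linear_within_zero:
  assumes "linear_within L T" "0 \<in> L"
  shows "T 0 = 0"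
  using assms unfolding linear_within_def by (metis scaleR_zero_left)

lemma linear_within_sum:
  assumes T: "linear_within L T" and L: "subspace L" and "finite I" "\<And>i. i \<in> I \<Longrightarrow> x i \<in> L"
  shows "T (\<Sum>i\<in>I. a i *\<^sub>R x i) = (\<Sum>i\<in>I. a i *\<^sub>R T (x i))"
  using assms(3,4)
proof (induction I)
  case empty
  then show ?case using linear_within_zero[OF T] L by (simp add: subspace_0)
next
  case (insert i I)
  then show ?case
    using T L by (simp add: linear_within_def subspace_scale subspace_sum)
qed

text \<open>The sign with which \<open>j k\<close> passes a vector: the volume form commutes with
  vectors, the other two operators anticommute.\<close>

definition eps :: "nat \<Rightarrow> real" where "eps k = (if k = 1 then 1 else - 1)"

lemma eps_sq [simp]: "eps k * eps k = 1" "eps k * (eps k * x) = x"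
  by (simp_all add: eps_def)

text \<open>The fibre at one point, with \<open>L\<close> for \<xi>. The \<open>j k\<close> enter
  through the quaternion relations and the signs \<open>eps\<close>; the orientation enters later,
  through the value of \<open>c r \<eta>\<close>.\<close>

locale su2_spinor = clifford_action g c
  for g :: "'v::euclidean_space \<Rightarrow> 'v \<Rightarrow> real" and c :: "'v \<Rightarrow> 'w::real_inner \<Rightarrow> 'w" +
  fixes j :: "nat \<Rightarrow> 'w \<Rightarrow> 'w" and \<eta> :: 'w and L :: "'v set"
  assumes linear_j: "k \<in> {1..3} \<Longrightarrow> linear (j k)"
    and j_sq: "k \<in> {1..3} \<Longrightarrow> j k (j k w) = - w"
    and j_skew: "k \<in> {1..3} \<Longrightarrow> j k w \<bullet> w' = - (w \<bullet> j k w')"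
    and c_j: "k \<in> {1..3} \<Longrightarrow> c v (j k w) = eps k *\<^sub>R j k (c v w)"
    and j_12: "j 1 (j 2 w) = j 3 w" and j_21: "j 2 (j 1 w) = - j 3 w"
    and eta_unit: "\<eta> \<bullet> \<eta> = 1"
    and subspace_L: "subspace L" and dim_L: "dim L = 4"
    and c_L: "(\<lambda>x. c x \<eta>) ` L = (span {\<eta>, j 1 \<eta>, j 2 \<eta>, j 3 \<eta>})\<^sup>\<bottom>"
begin

lemma j_simps:
  assumes "k \<in> {1..3}"
  shows "j k (x + y) = j k x + j k y" "j k (x - y) = j k x - j k y" "j k (- x) = - j k x"
    "j k (a *\<^sub>R x) = a *\<^sub>R j k x" "j k (sum f A) = (\<Sum>i\<in>A. j k (f i))" "j k 0 = 0"
  using linear_j[OF assms]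
  by (simp_all add: linear_add linear_diff linear_neg linear_scale linear_sum linear_0)

lemma j_mult:
  "j 1 (j 1 w) = - w" "j 2 (j 2 w) = - w" "j 3 (j 3 w) = - w"
  "j 1 (j 2 w) = j 3 w" "j 2 (j 1 w) = - j 3 w"
  "j 1 (j 3 w) = - j 2 w" "j 3 (j 1 w) = j 2 w"
  "j 2 (j 3 w) = j 1 w" "j 3 (j 2 w) = - j 1 w"
proof -
  show 1: "j 1 (j 1 w) = - w" "j 2 (j 2 w) = - w" "j 3 (j 3 w) = - w" for w
    by (rule j_sq; simp)+
  show 2: "j 1 (j 2 w) = j 3 w" "j 2 (j 1 w) = - j 3 w" for w
    by (rule j_12 j_21)+
  show 3: "j 1 (j 3 w) = - j 2 w"
    by (simp only: 1 flip: j_12)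
  show "j 3 (j 2 w) = - j 1 w"
    using 2(1)[of "j 2 w"] by (simp add: 1 j_simps)
  show "j 3 (j 1 w) = j 2 w"
    using 2(1)[of "j 1 w"] by (simp add: 2(2) j_simps 3)
  show "j 2 (j 3 w) = j 1 w"
    using 2(2)[of "j 2 w"] by (simp add: 2(1) \<open>j 3 (j 2 w) = - j 1 w\<close>)
qed

lemma eta_nz: "\<eta> \<noteq> 0"
  using eta_unit by auto

lemma c_eta_inj: "c x \<eta> = c y \<eta> \<longleftrightarrow> x = y"
  using c_eq_0[of "x - y" \<eta>] eta_nz by (auto simp: c_simps)

lemma g_eq: "g x y = c x \<eta> \<bullet> c y \<eta>"
  using g_inner[of x y \<eta>] eta_unit by simp

section \<open>Complex structures on \<xi> and the quaternionic basis\<close>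

definition J :: "nat \<Rightarrow> 'v \<Rightarrow> 'v" where
  "J k x = (THE y. y \<in> L \<and> c y \<eta> = j k (c x \<eta>))"

text \<open>The span of \<eta> and the \<open>j k \<eta>\<close> is invariant under
  \<open>j k\<close>; since \<open>j k\<close> is skew, so is its orthogonal complement, which is
  the image of \<open>L\<close>.\<close>

lemma J:
  assumes k: "k \<in> {1..3}" and x: "x \<in> L"
  shows "J k x \<in> L" "c (J k x) \<eta> = j k (c x \<eta>)"
proof -
  let ?G = "{\<eta>, j 1 \<eta>, j 2 \<eta>, j 3 \<eta>}"
  have "j k ` ?G \<subseteq> span ?G"
    using k unfolding one_to_three
    by (elim disjE) (auto simp: j_mult intro: span_neg span_base)
  then have jG: "j k y \<in> span ?G" if "y \<in> span ?G" for y
    using that span_minimal[of "j k ` ?G" "span ?G"] linear_span_image[OF linear_j[OF k], of ?G] by auto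
  have "j k (c x \<eta>) \<in> (span ?G)\<^sup>\<bottom>"
  proof -
    have x': "c x \<eta> \<in> (span ?G)\<^sup>\<bottom>" using x c_L by blast
    have "y \<bullet> j k (c x \<eta>) = 0" if "y \<in> span ?G" for y
      using x' jG[OF that] j_skew[OF k, of y "c x \<eta>"] unfolding orthogonal_comp_def orthogonal_def by fastforce
    then show ?thesis by (simp add: orthogonal_comp_def orthogonal_def)
  qed
  then obtain y where y: "y \<in> L" "c y \<eta> = j k (c x \<eta>)"
    using c_L by (metis (no_types, lifting) imageE)
  then have "J k x = y"
    unfolding J_def by (intro the_equality) (auto simp flip: c_eta_inj)
  with y show "J k x \<in> L" "c (J k x) \<eta> = j k (c x \<eta>)" by auto
qed

lemma J_eqI: "k \<in> {1..3} \<Longrightarrow> x \<in> L \<Longrightarrow> c y \<eta> = j k (c x \<eta>) \<Longrightarrow> J k x = y"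
  using J(2)[of k x] c_eta_inj by metis

lemma unit_exists: obtains b where "b \<in> L" "g b b = 1"
proof -
  have "L \<noteq> {0}" using dim_L by auto
  then obtain x where x: "x \<in> L" "x \<noteq> 0"
    using subspace_0[OF subspace_L] by auto
  define b where "b = (1 / sqrt (g x x)) *\<^sub>R x"
  have "b \<in> L" using x subspace_L by (simp add: b_def subspace_scale)
  moreover have "g b b = 1"
    using g_pos[OF x(2)] by (simp add: b_def g_simps divide_simps)
  ultimately show thesis by (rule that)
qed

text \<open>The vector \<open>b\<close> takes index 0, so that the indices 1 to 3 agree with those
  of \<open>J\<close>.\<close>

definition basis :: "'v \<Rightarrow> nat \<Rightarrow> 'v" where
  "basis b i = (if i = 0 then b else J i b)"

text \<open>By \<open>g_eq\<close> this is a statement about the spinor \<open>c b \<eta>\<close>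
  and its images under the \<open>j k\<close>: two distinct \<open>j k\<close> multiply to plus or
  minus the third, and a skew operator takes a spinor to an orthogonal one.\<close>

lemma ortho_basis:
  assumes b: "b \<in> L" "g b b = 1"
  shows "ortho {..3} (basis b)" "basis b ` {..3} \<subseteq> L"
proof -
  have J': "J k b \<in> L" "c (J k b) \<eta> = j k (c b \<eta>)" if "k \<in> {1..3}" for k
    using J[OF that b(1)] by auto
  let ?y = "c b \<eta>"
  have y: "?y \<bullet> ?y = 1" using b(2) by (simp add: g_eq)
  have sk: "?y \<bullet> j k ?y = 0" "j k ?y \<bullet> ?y = 0" if "k \<in> {1..3}" for k
    using j_skew[OF that, of ?y ?y] inner_commute[of ?y "j k ?y"] by linarith+
  have jj: "j k ?y \<bullet> j l ?y = (if k = l then 1 else 0)" if "k \<in> {1..3}" "l \<in> {1..3}" for k l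
    using that unfolding one_to_three by (elim disjE) (simp_all add: j_skew j_mult y sk)
  have "g (basis b i) (basis b k) = (if i = k then 1 else 0)" if "i \<in> {..3}" "k \<in> {..3}" for i k
  proof -
    have "i = 0 \<or> i \<in> {1..3} \<and> i \<noteq> 0" "k = 0 \<or> k \<in> {1..3} \<and> k \<noteq> 0" using that by auto
    then show ?thesis
      by (elim disjE conjE) (simp_all add: basis_def g_eq J' jj sk y del: atLeastAtMost_iff)
  qed
  then show "ortho {..3} (basis b)" by (simp add: ortho_def)
  show "basis b ` {..3} \<subseteq> L"
    using b J' by (auto simp: basis_def)
qed

text \<open>As \<open>T\<close> commutes with \<open>J\<^sub>k\<close>, the summand of \<open>J\<^sub>k b\<close> is \<open>T b \<cdot> b \<cdot> \<eta>\<close> plus a multiple of \<open>\<jmath>\<^sub>k \<eta>\<close>; the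
  multiples add up to \<open>-2 T b \<cdot> b \<cdot> \<eta>\<close>, because \<open>T b\<close> is a combination of the \<open>J\<^sub>k b\<close>.\<close>

lemma c_trace_skew_commuting:
  assumes b: "b \<in> L" "g b b = 1" and T: "T b \<in> L" and skew: "g (T b) b = 0"
    and TJ: "\<And>k. k \<in> {1..3} \<Longrightarrow> T (J k b) = J k (T b)"
  shows "(\<Sum>i\<in>{..3}. c (basis b i) (c (T (basis b i)) \<eta>)) = 0"
proof -
  define a where "a k = g (T b) (J k b)" for k
  let ?z = "c (T b) (c b \<eta>)"
  have anti: "c b (c (T b) \<eta>) = - ?z"
    using skew by (subst c_anticomm) (simp add: g_sym)
  have Tb: "T b = (\<Sum>k\<in>{1..3}. a k *\<^sub>R J k b)"
    using ortho_span(1)[OF ortho_basis(1)[OF b] _ ortho_basis(2)[OF b] _ T] dim_L skew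
    unfolding sum_one_to_three by (simp add: atMost_three basis_def a_def add.assoc)
  have "?z = - c b (c (T b) \<eta>)" using anti by simp
  also have "\<dots> = - (\<Sum>k\<in>{1..3}. a k *\<^sub>R c b (c (J k b) \<eta>))"
    by (subst Tb) (simp add: c_sum c_simps)
  also have "\<dots> = (\<Sum>k\<in>{1..3}. (eps k * a k) *\<^sub>R j k \<eta>)"
    by (simp add: J(2) b c_j c_sq j_simps mult.commute flip: sum_negf)
  finally have z: "?z = (\<Sum>k\<in>{1..3}. (eps k * a k) *\<^sub>R j k \<eta>)" .
  \<comment> \<open>The operator \<open>j k\<close> is pulled to the front twice, before and after
    \<open>J k b\<close> and \<open>T b\<close> are swapped; the two signs \<open>eps k\<close>
    cancel, and \<open>j k\<close> squared cancels the minus sign of the swap.\<close>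
  have step: "c (J k b) (c (T (J k b)) \<eta>) = ?z - (2 * eps k * a k) *\<^sub>R j k \<eta>" if k: "k \<in> {1..3}" for k
  proof -
    have "c (J k b) (c (T (J k b)) \<eta>) = eps k *\<^sub>R j k (c (J k b) (c (T b) \<eta>))"
      by (simp add: TJ[OF k] J(2)[OF k T] c_j[OF k])
    also have "c (J k b) (c (T b) \<eta>) = - eps k *\<^sub>R j k ?z - (2 * a k) *\<^sub>R \<eta>"
      by (subst c_anticomm) (simp add: J(2)[OF k b(1)] c_j[OF k] g_sym a_def)
    also have "eps k *\<^sub>R j k (- eps k *\<^sub>R j k ?z - (2 * a k) *\<^sub>R \<eta>) = ?z - (2 * eps k * a k) *\<^sub>R j k \<eta>"
      by (simp add: j_simps[OF k] j_sq[OF k] algebra_simps)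
    finally show ?thesis .
  qed
  have "(\<Sum>i\<in>{..3}. c (basis b i) (c (T (basis b i)) \<eta>))
      = c b (c (T b) \<eta>) + (\<Sum>k\<in>{1..3}. c (J k b) (c (T (J k b)) \<eta>))"
    unfolding sum_one_to_three by (simp add: atMost_three basis_def add.assoc)
  also have "\<dots> = - ?z + (\<Sum>k\<in>{1..3}. ?z - (2 * eps k * a k) *\<^sub>R j k \<eta>)"
    using step anti by simp
  also have "\<dots> = - ?z + (\<Sum>k\<in>{1..3::nat}. ?z) - 2 *\<^sub>R (\<Sum>k\<in>{1..3}. (eps k * a k) *\<^sub>R j k \<eta>)"
    by (simp add: sum_subtractf scaleR_sum_right mult.assoc)
  also have "\<dots> = - ?z + (?z + ?z + ?z) - (?z + ?z)"
    unfolding z[symmetric] sum_one_to_three scaleR_2 ..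
  also have "\<dots> = 0" by simp
  finally show ?thesis .
qed

text \<open>Every summand is the same: \<open>j k\<close> moves to the front with sign
  \<open>eps k\<close>, leaving the square of a unit vector.\<close>

lemma c_trace_J:
  assumes u: "ortho I u" "u ` I \<subseteq> L" and k: "k \<in> {1..3}"
  shows "(\<Sum>i\<in>I. c (u i) (c (J k (u i)) \<eta>)) = - (real (card I) * eps k) *\<^sub>R j k \<eta>"
proof -
  have "c (u i) (c (J k (u i)) \<eta>) = - eps k *\<^sub>R j k \<eta>" if "i \<in> I" for i
    using u k that by (auto simp: ortho_def J(2) image_subset_iff c_j c_sq j_simps)
  then show ?thesis by (simp add: sum_constant_scaleR)
qed

section \<open>Projection to \<xi> and metric duals\<close>

definition pr :: "'v \<Rightarrow> 'v" where
  "pr x = (THE y. y \<in> L \<and> (\<forall>z\<in>L. g (x - y) z = 0))"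

definition dual :: "('v \<Rightarrow> real) \<Rightarrow> 'v" where
  "dual \<theta> = (THE y. y \<in> L \<and> (\<forall>x\<in>L. g y x = \<theta> x))"

lemma expand_basis:
  assumes "b \<in> L" "g b b = 1" "x \<in> L"
  shows "x = (\<Sum>i\<in>{..3}. g x (basis b i) *\<^sub>R basis b i)"
  using ortho_span(1)[OF ortho_basis(1) _ ortho_basis(2)] assms dim_L by simp

lemma g_basis:
  assumes "b \<in> L" "g b b = 1" "i \<in> {..3}" "k \<in> {..3}"
  shows "g (basis b i) (basis b k) = (if i = k then 1 else 0)"
  using ortho_basis(1)[OF assms(1,2)] assms(3,4) by (simp add: ortho_def)

lemma L_eqI:
  assumes "x \<in> L" "y \<in> L" "\<And>z. z \<in> L \<Longrightarrow> g x z = g y z"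
  shows "x = y"
proof -
  have "g (x - y) (x - y) = 0"
    using assms subspace_diff[OF subspace_L] by (simp add: bilinear_lsub[OF bilinear_g])
  then show ?thesis using g_pos[of "x - y"] by force
qed

text \<open>The dual vector is written down in the quaternionic basis, with the values of
  \<open>\<theta>\<close> on that basis as coefficients.\<close>

lemma dual:
  assumes "linear_within L \<theta>"
  shows "dual \<theta> \<in> L" "x \<in> L \<Longrightarrow> g (dual \<theta>) x = \<theta> x"
proof -
  obtain b where b: "b \<in> L" "g b b = 1" by (rule unit_exists)
  define y where "y = (\<Sum>i\<in>{..3}. \<theta> (basis b i) *\<^sub>R basis b i)"
  have y: "y \<in> L"
    unfolding y_def using subspace_L ortho_basis(2)[OF b] by (intro subspace_sum subspace_scale) auto
  have gy: "g y x = \<theta> x" if "x \<in> L" for x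
  proof -
    have "\<theta> x = \<theta> (\<Sum>i\<in>{..3}. g x (basis b i) *\<^sub>R basis b i)"
      using expand_basis[OF b that] by (rule arg_cong)
    also have "\<dots> = (\<Sum>i\<in>{..3}. g x (basis b i) *\<^sub>R \<theta> (basis b i))"
      using ortho_basis(2)[OF b] by (intro linear_within_sum[OF assms subspace_L]) auto
    finally show ?thesis
      by (simp add: y_def g_sum g_simps g_sym mult.commute)
  qed
  have "dual \<theta> = y"
    unfolding dual_def using y gy by (intro the_equality L_eqI) simp_all
  with y gy show "dual \<theta> \<in> L" "x \<in> L \<Longrightarrow> g (dual \<theta>) x = \<theta> x" by auto
qed

text \<open>The projection of \<open>x\<close> is the metric dual of the functional
  \<open>g x\<close> restricted to \<open>L\<close>.\<close>

lemma pr: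
  shows "pr x \<in> L" "z \<in> L \<Longrightarrow> g (pr x) z = g x z" "x \<in> L \<Longrightarrow> pr x = x"
proof -
  have "pr x = dual (g x)"
    by (simp add: pr_def dual_def bilinear_lsub[OF bilinear_g] eq_commute[of "g x _"])
  moreover have "linear_within L (g x)"
    by (simp add: linear_within_def g_simps)
  ultimately show 1: "pr x \<in> L" "z \<in> L \<Longrightarrow> g (pr x) z = g x z" for z
    using dual by auto
  then show "x \<in> L \<Longrightarrow> pr x = x" by (intro L_eqI)
qed

text \<open>Moving \<open>r\<close> past four orthogonal vectors costs no sign, and the product of
  the quaternionic basis takes \<eta> to its negative. When the five vectors multiply to the volume
  form, this determines \<open>c r \<eta>\<close>.\<close>

lemma c_basis_product:
  assumes b: "b \<in> L" "g b b = 1" and r: "\<And>x. x \<in> L \<Longrightarrow> g r x = 0"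
  shows "c b (c (J 1 b) (c (J 2 b) (c (J 3 b) (c r \<eta>)))) = - c r \<eta>"
proof -
  have r_anti: "c x (c r w) = - c r (c x w)" if "x \<in> L" for x w
    using r[OF that] by (subst c_anticomm) (simp add: g_sym)
  have "c (J 2 b) (c b w) = - c b (c (J 2 b) w)" for w
    using g_basis[OF b, of 2 0] by (subst c_anticomm) (simp add: basis_def)
  then have J23: "c (J 2 b) (c (J 3 b) \<eta>) = - j 1 \<eta>"
    by (simp add: J(2) b c_j eps_def j_simps j_mult c_sq c_simps)
  have "c b (c (J 1 b) (c (J 2 b) (c (J 3 b) \<eta>))) = - \<eta>"
    unfolding J23 by (simp add: J(2) b c_j eps_def j_simps j_mult c_sq c_simps)
  then show ?thesis
    by (simp add: r_anti J(1) b c_simps)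
qed

text \<open>Shows that the quaternionic basis is positive for the orientation of \<xi>. Of the three
  products only the first survives, since \<open>J 1\<close> takes \<open>b\<close> to
  \<open>J 1 b\<close> and \<open>J 2 b\<close> to \<open>J 3 b\<close>.\<close>

lemma wedge_square_basis:
  assumes b: "b \<in> L" "g b b = 1"
  shows "wedge_square (\<lambda>x y. g (J 1 (pr x)) (pr y)) b (J 1 b) (J 2 b) (J 3 b) = 2"
proof -
  have o: "g (J k b) (J l b) = (if k = l then 1 else 0)" if "k \<in> {1..3}" "l \<in> {1..3}" for k l
    using g_basis[OF b, of k l] that by (simp add: basis_def split: if_splits)
  have "J 1 (J 2 b) = J 3 b"
    by (rule J_eqI) (auto simp: J b j_mult)
  then show ?thesis
    by (simp add: wedge_square_def pr(3) J b o)
qed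

text \<open>The pointwise algebra, with \<open>F\<close> for the covariant derivative of \<eta>: the
  trace is moved from the frame \<open>e\<close> to the quaternionic basis followed by
  \<open>r\<close>, and each component of \<open>F\<close> is then contracted separately.\<close>

lemma dirac_formula:
  assumes e: "ortho (UNIV :: 'k::finite set) e" "CARD('k) = DIM('v)"
    and b: "b \<in> L" "g b b = 1"
    and r: "\<And>x. x \<in> L \<Longrightarrow> g r x = 0" "c r \<eta> = - j 1 \<eta>"
    and F: "\<And>x. F x = c (S (pr x)) \<eta> + g r x *\<^sub>R c V \<eta>
        + (\<Sum>l\<in>{1..3}. (\<Theta> l (pr x) + g r x * \<phi> l) *\<^sub>R j l \<eta>)"
    and V: "V \<in> L" and S: "linear_within L S"
    and \<Theta>: "\<And>l. l \<in> {1..3} \<Longrightarrow> linear_within L (\<Theta> l)"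
    and S_eq: "\<And>x. x \<in> L \<Longrightarrow> S x = \<mu> *\<^sub>R x + (\<Sum>l\<in>{1..3}. Sl l x) + (\<Sum>l\<in>{1..3}. lam l *\<^sub>R J l x) + S0 x"
    and Sl: "\<And>l. l \<in> {1..3} \<Longrightarrow> Sl l ` L \<subseteq> L"
      "\<And>l x y. l \<in> {1..3} \<Longrightarrow> x \<in> L \<Longrightarrow> y \<in> L \<Longrightarrow> g (Sl l x) y = g x (Sl l y)"
      "\<And>l. l \<in> {1..3} \<Longrightarrow> (\<Sum>i\<in>{..3}. g (Sl l (basis b i)) (basis b i)) = 0"
    and S0: "S0 ` L \<subseteq> L" "\<And>x y. x \<in> L \<Longrightarrow> y \<in> L \<Longrightarrow> g (S0 x) y = - g x (S0 y)"
      "\<And>l x. l \<in> {1..3} \<Longrightarrow> x \<in> L \<Longrightarrow> S0 (J l x) = J l (S0 x)"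
  shows "(\<Sum>a\<in>UNIV. c (e a) (F (e a))) =
    (- 4 * \<mu> + \<phi> 1) *\<^sub>R \<eta> - (4 * lam 1) *\<^sub>R j 1 \<eta> + (4 * lam 2 + \<phi> 3) *\<^sub>R j 2 \<eta> + (4 * lam 3 - \<phi> 2) *\<^sub>R j 3 \<eta>
    + c (J 1 (V + dual (\<Theta> 1)) - J 2 (dual (\<Theta> 2)) - J 3 (dual (\<Theta> 3))) \<eta>"
proof -
  let ?u = "basis b"
  \<comment> \<open>\<open>H\<close> is the value of \<open>F\<close> at \<open>r\<close>, and
    \<open>G i\<close> its value at the basis vector of index \<open>i\<close>.\<close>
  define H where "H = c V \<eta> + (\<Sum>l\<in>{1..3}. \<phi> l *\<^sub>R j l \<eta>)"
  define G where "G i = c (S (?u i)) \<eta> + (\<Sum>l\<in>{1..3}. \<Theta> l (?u i) *\<^sub>R j l \<eta>)" for i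
  note u = ortho_basis[OF b]
  have uL: "?u i \<in> L" if "i \<in> {..3}" for i using u(2) that by blast
  have F_sum: "F x = (\<Sum>i\<in>{..3}. g x (?u i) *\<^sub>R G i) + g x r *\<^sub>R H" for x
  proof -
    have px: "pr x = (\<Sum>i\<in>{..3}. g x (?u i) *\<^sub>R ?u i)"
      using expand_basis[OF b pr(1)[of x]] by (simp add: pr(2) uL)
    have "S (pr x) = (\<Sum>i\<in>{..3}. g x (?u i) *\<^sub>R S (?u i))"
      unfolding px using uL by (intro linear_within_sum[OF S subspace_L]) auto
    moreover have "\<Theta> l (pr x) = (\<Sum>i\<in>{..3}. g x (?u i) *\<^sub>R \<Theta> l (?u i))" if "l \<in> {1..3}" for l
      unfolding px using uL by (intro linear_within_sum[OF \<Theta>[OF that] subspace_L]) auto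
    ultimately show ?thesis
      by (simp add: F G_def H_def c_sum c_simps g_sym[of r x] sum_one_to_three scaleR_sum_left
          scaleR_right_distrib scaleR_left_distrib sum.distrib add_ac)
  qed
  \<comment> \<open>Index 4 stands for \<open>r\<close>, so that one sum runs over the whole
    basis.\<close>
  have "F x = (\<Sum>i\<in>{..4::nat}. g x (if i = 4 then r else ?u i) *\<^sub>R (if i = 4 then H else G i))" for x
  proof -
    have "{..4::nat} = insert 4 {..3}" by auto
    then show ?thesis unfolding F_sum by (simp add: add.commute)
  qed
  from c_trace_frame_change[OF e this]
  have D: "(\<Sum>a\<in>UNIV. c (e a) (F (e a))) = (\<Sum>i\<in>{..3}. c (?u i) (G i)) + c r H"
  proof -
    have "{..4::nat} = insert 4 {..3}" by auto
    then show ?thesis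
      unfolding \<open>(\<Sum>a\<in>UNIV. c (e a) (F (e a))) = _\<close> by (simp add: add.commute)
  qed
  have tr_id: "(\<Sum>i\<in>{..3}. c (?u i) (c (?u i) \<eta>)) = - 4 *\<^sub>R \<eta>"
  proof -
    have "c (?u i) (c (?u i) \<eta>) = - \<eta>" if "i \<in> {..3}" for i
      using u(1) that by (simp add: c_sq ortho_def)
    then show ?thesis by (simp add: sum_constant_scaleR)
  qed
  have tr_Sl: "(\<Sum>i\<in>{..3}. c (?u i) (c (Sl l (?u i)) \<eta>)) = 0" if l: "l \<in> {1..3}" for l
    using c_trace_symmetric[OF u(1) _ u(2) _ Sl(1)[OF l] Sl(2)[OF l]] Sl(3)[OF l] dim_L by simp
  have tr_J: "(\<Sum>i\<in>{..3}. c (?u i) (c (J l (?u i)) \<eta>)) = - (4 * eps l) *\<^sub>R j l \<eta>" if l: "l \<in> {1..3}" for l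
    using c_trace_J[OF u l] by simp
  have tr_S0: "(\<Sum>i\<in>{..3}. c (?u i) (c (S0 (?u i)) \<eta>)) = 0"
  proof (rule c_trace_skew_commuting[OF b])
    show "g (S0 b) b = 0" using S0(2)[OF b(1) b(1)] g_sym[of b "S0 b"] by simp
  qed (use S0 b in auto)
  have tr_S: "(\<Sum>i\<in>{..3}. c (?u i) (c (S (?u i)) \<eta>)) =
      - (4 * \<mu>) *\<^sub>R \<eta> - (\<Sum>l\<in>{1..3}. (4 * lam l * eps l) *\<^sub>R j l \<eta>)"
  proof -
    have "(\<Sum>i\<in>{..3}. c (?u i) (c (S (?u i)) \<eta>)) = (\<Sum>i\<in>{..3}. \<mu> *\<^sub>R c (?u i) (c (?u i) \<eta>)
        + (\<Sum>l\<in>{1..3}. c (?u i) (c (Sl l (?u i)) \<eta>)) + (\<Sum>l\<in>{1..3}. lam l *\<^sub>R c (?u i) (c (J l (?u i)) \<eta>))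
        + c (?u i) (c (S0 (?u i)) \<eta>))"
      by (intro sum.cong refl) (simp add: S_eq uL c_simps c_sum)
    also have "\<dots> = \<mu> *\<^sub>R (- 4 *\<^sub>R \<eta>) + (\<Sum>l\<in>{1..3}. lam l *\<^sub>R (- (4 * eps l) *\<^sub>R j l \<eta>))"
      using tr_id tr_Sl tr_J tr_S0
      by (simp only: sum.distrib scaleR_sum_right[symmetric] sum.swap[of _ "{1..3}" "{..3}"]) simp
    finally show ?thesis by (simp add: sum_negf mult_ac)
  qed
  \<comment> \<open>Pulling \<open>j l\<close> out leaves the expansion of the dual vector;
    \<open>eps l\<close> is the source of the minus signs at \<open>J 2\<close> and
    \<open>J 3\<close>.\<close>
  have tr_\<Theta>: "(\<Sum>i\<in>{..3}. c (?u i) (\<Theta> l (?u i) *\<^sub>R j l \<eta>)) = eps l *\<^sub>R j l (c (dual (\<Theta> l)) \<eta>)"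
    if l: "l \<in> {1..3}" for l
  proof -
    have "c (dual (\<Theta> l)) \<eta> = (\<Sum>i\<in>{..3}. \<Theta> l (?u i) *\<^sub>R c (?u i) \<eta>)"
      by (subst expand_basis[OF b dual(1)[OF \<Theta>[OF l]]])
        (simp add: dual(2)[OF \<Theta>[OF l]] uL c_sum c_simps)
    then show ?thesis
      by (simp add: c_simps c_j[OF l] j_simps[OF l] scaleR_sum_right mult.commute)
  qed
  have "(\<Sum>i\<in>{..3}. c (?u i) (G i)) = (\<Sum>i\<in>{..3}. c (?u i) (c (S (?u i)) \<eta>))
      + (\<Sum>l\<in>{1..3}. \<Sum>i\<in>{..3}. c (?u i) (\<Theta> l (?u i) *\<^sub>R j l \<eta>))"
    by (subst sum.swap) (simp add: G_def c_simps(2) c_sum sum.distrib)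
  also have "\<dots> = - (4 * \<mu>) *\<^sub>R \<eta> - (\<Sum>l\<in>{1..3}. (4 * lam l * eps l) *\<^sub>R j l \<eta>)
      + (\<Sum>l\<in>{1..3}. eps l *\<^sub>R j l (c (dual (\<Theta> l)) \<eta>))"
    using tr_S tr_\<Theta> by simp
  finally have G_sum: "(\<Sum>i\<in>{..3}. c (?u i) (G i)) = \<dots>" .
  \<comment> \<open>\<open>V\<close> is orthogonal to \<open>r\<close>, and the sign from
    anticommuting cancels the one in \<open>c r \<eta> = - j 1 \<eta>\<close>.\<close>
  have "c r (c V \<eta>) = j 1 (c V \<eta>)"
    by (subst c_anticomm) (simp add: r V c_simps c_j eps_def)
  \<comment> \<open>By the quaternion relations, \<open>\<phi> 1\<close> lands on \<eta>,
    \<open>\<phi> 2\<close> on \<open>j 3 \<eta>\<close> with a minus sign, and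
    \<open>\<phi> 3\<close> on \<open>j 2 \<eta>\<close>.\<close>
  moreover have "c r (j l \<eta>) = - eps l *\<^sub>R j l (j 1 \<eta>)" if "l \<in> {1..3}" for l
    using that by (simp add: c_j r j_simps)
  ultimately have H: "c r H = j 1 (c V \<eta>) + \<phi> 1 *\<^sub>R \<eta> - \<phi> 2 *\<^sub>R j 3 \<eta> + \<phi> 3 *\<^sub>R j 2 \<eta>"
    by (simp add: H_def sum_one_to_three c_simps eps_def j_mult)
  have "c (J 1 (V + dual (\<Theta> 1)) - J 2 (dual (\<Theta> 2)) - J 3 (dual (\<Theta> 3))) \<eta> =
      j 1 (c V \<eta>) + j 1 (c (dual (\<Theta> 1)) \<eta>) - j 2 (c (dual (\<Theta> 2)) \<eta>) - j 3 (c (dual (\<Theta> 3)) \<eta>)"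
    using subspace_add[OF subspace_L V] by (simp add: J(2) dual(1) \<Theta> c_simps j_simps)
  then show ?thesis
    unfolding D G_sum H sum_one_to_three by (simp add: eps_def algebra_simps)
qed

end

section \<open>The Dirac operator\<close>

text \<open>Applying \<open>f\<close> to all rows multiplies the determinant by that of
  \<open>f\<close>; this compares the orientation of a basis with that of its coordinates in the
  frame.\<close>

lemma matrix_of_images:
  assumes "linear (f :: real^'n \<Rightarrow> real^'n)"
  shows "(\<chi> i. f (A $ i)) = A ** transpose (matrix f)"
proof -
  have "f (A $ i) = matrix f *v (A $ i)" for i
    using assms by (simp add: matrix_works)
  then show ?thesis
    by (simp add: vec_eq_iff matrix_matrix_mult_def matrix_vector_mult_def transpose_def mult.commute)
qed

text \<open>Transports the Clifford action from \<open>real^5\<close> to the tangent space along the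
  coordinate map of the frame.\<close>

lemma clifford_action_isometry:
  assumes "clifford_action (\<bullet>) c" "linear h" "inj h" "\<And>x y. g x y = h x \<bullet> h y"
  shows "clifford_action g (\<lambda>x. c (h x))"
proof -
  interpret clifford_action "(\<bullet>)" c by fact
  show ?thesis
  proof
    show "bilinear g" "bilinear (\<lambda>x. c (h x))"
      using assms(2) by (auto simp: bilinear_def assms(4) linear_iff c_simps inner_simps)
    show "g x x > 0" if "x \<noteq> 0" for x
      using that assms(2-4) by (metis inner_gt_zero_iff linear_injective_0)
    show "g x y = g y x" for x y by (simp add: assms(4) inner_commute)
    show "c (h v) w \<bullet> w' = - (w \<bullet> c (h v) w')" for v w w' by (rule c_skew)
  qed (simp add: assms(4) c_sq)
qed

theorem proposition4p14:
  fixes M :: "('m::{t2_space, second_countable_topology}, 'i, 'w::euclidean_space) spin_data"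
    and j2 :: "'m \<Rightarrow> 'w \<Rightarrow> 'w"
    and \<eta> :: "'m \<Rightarrow> 'w"
    and \<xi> :: "'m \<Rightarrow> (real^5) set"
    and R V :: "'m \<Rightarrow> real^5"
    and S S0 :: "'m \<Rightarrow> real^5 \<Rightarrow> real^5"
    and Sl :: "nat \<Rightarrow> 'm \<Rightarrow> real^5 \<Rightarrow> real^5"
    and \<Theta> :: "nat \<Rightarrow> 'm \<Rightarrow> real^5 \<Rightarrow> real"
    and \<mu> :: "'m \<Rightarrow> real"
    and \<phi> lam :: "nat \<Rightarrow> 'm \<Rightarrow> real"
    and p :: 'm
  defines "j \<equiv> jop M j2" and "J \<equiv> Jop M j2 \<eta> \<xi>"
  assumes "spin_manifold M"
    and "is_j2 M j2"
    and "smooth_spinor_on M UNIV \<eta>" and "\<forall>q. norm (\<eta> q) = 1"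
    and "spinor_distribution M j2 \<eta> \<xi>"
    and "unit_normal_field M j2 \<eta> \<xi> R"
    and "nabla_decomposition M j2 \<eta> \<xi> R S V \<Theta> \<phi>"
    and "endo_decomposition M j2 \<eta> \<xi> S \<mu> lam Sl S0"
  shows "dirac M \<eta> p =
    (- 4 * \<mu> p + \<phi> 1 p) *\<^sub>R \<eta> p
    - (4 * lam 1 p) *\<^sub>R j 1 p (\<eta> p)
    + (4 * lam 2 p + \<phi> 3 p) *\<^sub>R j 2 p (\<eta> p)
    + (4 * lam 3 p - \<phi> 2 p) *\<^sub>R j 3 p (\<eta> p)
    + cliff M p (J 1 p (V p + sharp M \<xi> (\<Theta> 1) p) - J 2 p (sharp M \<xi> (\<Theta> 2) p) - J 3 p (sharp M \<xi> (\<Theta> 3) p)) (\<eta> p)"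
proof -

  \<comment> \<open>The Clifford action on the tangent space at \<open>p\<close>\<close>
  define f where "f = frame M (idx M p) p"
  define h where "h = inv f"
  let ?g = "metric M p" and ?c = "cliff M p" and ?cl = "clif M" and ?j = "\<lambda>k. jop M j2 k p"
  have sm: "riemannian_metric M" "irreducible_Cl5_module ?cl" "spin_structure M"
    using assms(3) by (auto simp: spin_manifold_def)
  have "p \<in> (\<Union>i. cover M i)" using sm(3) by (simp add: spin_structure_def)
  then have "p \<in> cover M (idx M p)" unfolding idx_def by (auto intro: someI)
  then have f: "linear f" "\<And>x y. ?g (f x) (f y) = x \<bullet> y" "det (matrix f) > 0"
    using sm(3) by (simp_all add: spin_structure_def f_def)
  have "bilinear ?g" using sm(1) by (simp add: riemannian_metric_def)
  have "inj f"
    unfolding linear_injective_0[OF f(1)] using f(2) \<open>bilinear ?g\<close>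
    by (metis bilinear_lzero inner_eq_zero_iff)
  then have "bij f" using f(1) by (simp add: bij_def linear_injective_imp_surjective)
  then have fh: "f (h x) = x" and hf: "h (f x) = x" for x
    by (simp_all add: h_def bij_is_surj surj_f_inv_f bij_is_inj)
  have h: "linear h" "inj h"
    using \<open>bij f\<close> f(1) by (simp_all add: h_def bij_imp_bij_inv bij_is_inj inj_linear_imp_inv_linear)
  have gh: "?g x y = h x \<bullet> h y" for x y
    using f(2)[of "h x" "h y"] by (simp add: fh)
  have c_eq: "?c = (\<lambda>x. ?cl (h x))"
    by (simp add: fun_eq_iff cliff_def cliff_in_def h_def f_def)
  have cl: "clifford_action (\<bullet>) ?cl"
    using sm(2) unfolding irreducible_Cl5_module_def clifford_action_def
    by (simp add: inner_commute[of _ "_ :: real^5"] power2_norm_eq_inner bilinear_conv_bounded_bilinear bounded_bilinear_inner)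
  interpret cl: clifford_action "(\<bullet>)" ?cl by (rule cl)
  interpret c: clifford_action ?g ?c
    unfolding c_eq by (rule clifford_action_isometry[OF cl h gh])

  \<comment> \<open>The volume form in the local frame\<close>
  let ?e = "\<lambda>a. onframe M (idx M p) a p"
  have e: "c.ortho UNIV ?e"
    by (simp add: c.ortho_def onframe_def f(2)[unfolded f_def] inner_axis_axis)
  have h_e: "h (?e a) = axis a 1" for a
    by (simp add: onframe_def hf flip: f_def)
  have e_anti: "?c (?e a) (?c (?e b) w) = - ?c (?e b) (?c (?e a) w)" if "a \<noteq> b" for a b w
    using e that by (subst c.c_anticomm) (simp add: c.ortho_def)
  have e_sq: "?c (?e a) (?c (?e a) w) = - w" for a w
    using e by (simp add: c.c_sq c.ortho_def)
  have vol: "vol M p (vol M p w) = - w" "?c (?e a) (vol M p w) = vol M p (?c (?e a) w)"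
    "?c (?e 5) (?c (?e 4) (?c (?e 3) (?c (?e 2) (?c (?e 1) w)))) = vol M p w" for a w
    unfolding vol_def Let_def
    by (rule five_anticommuting[of "\<lambda>a. ?c (?e a)"]; (rule e_sq c.c_simps(8) | erule e_anti))+
  \<comment> \<open>Five skew factors give a minus sign and the reversed product, which is again the
    volume form.\<close>
  have vol_skew: "vol M p w \<bullet> w' = - (w \<bullet> vol M p w')" for w w'
    by (subst vol(3)[symmetric]) (simp only: vol_def[unfolded Let_def] c.c_skew minus_minus inner_minus_right)
  have "linear (vol M p)"
    by (intro linearI) (simp_all add: vol_def c.c_simps)
  have vol_c: "vol M p (?c x w) = ?c x (vol M p w)" for x w
  proof -
    have "x = (\<Sum>a\<in>UNIV. ?g x (?e a) *\<^sub>R ?e a)"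
      by (rule c.ortho_span(1)[OF e, of UNIV]) auto
    then have "?c x w = ?c (\<Sum>a\<in>UNIV. ?g x (?e a) *\<^sub>R ?e a) w" for w
      by (rule arg_cong)
    then have "?c x w = (\<Sum>a\<in>UNIV. ?g x (?e a) *\<^sub>R ?c (?e a) w)" for w
      by (simp only: c.c_sum c.c_simps)
    then show ?thesis
      by (simp only: linear_sum[OF \<open>linear (vol M p)\<close>] linear_scale[OF \<open>linear (vol M p)\<close>] vol(2))
  qed

  \<comment> \<open>The quaternionic operators\<close>
  have j2: "linear (j2 p)" "norm (j2 p w) = norm w" "j2 p (j2 p w) = - w"
    "j2 p (?c x w) = - ?c x (j2 p w)" for w x
    using assms(4) by (auto simp: is_j2_def)
  \<comment> \<open>Passing five vectors gives an odd number of signs.\<close>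
  have j2_vol: "j2 p (vol M p w) = - vol M p (j2 p w)" for w
    by (simp add: vol_def j2 linear_neg[OF j2(1)] c.c_simps)
  have j2_skew: "j2 p w \<bullet> w' = - (w \<bullet> j2 p w')" for w w'
  proof -
    have "orthogonal_transformation (j2 p)"
      using j2 by (simp add: orthogonal_transformation)
    then have "j2 p (j2 p w) \<bullet> j2 p w' = j2 p w \<bullet> w'"
      by (simp add: orthogonal_transformation_def)
    then show ?thesis by (simp add: j2)
  qed

  interpret s: su2_spinor ?g ?c ?j "\<eta> p" "\<xi> p"
  proof (intro su2_spinor.intro su2_spinor_axioms.intro c.clifford_action_axioms)
    fix k :: nat and v :: "real^5" and w w' :: 'w assume k: "k \<in> {1..3}"
    show "linear (?j k)"
      using k \<open>linear (vol M p)\<close> j2(1) linear_compose[OF j2(1) \<open>linear (vol M p)\<close>]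
      by (auto simp: linear_iff jop_def o_def)
    then show "?j k (?j k w) = - w"
      using k \<open>linear (vol M p)\<close> by (auto simp: jop_def vol(1) j2 j2_vol linear_neg)
    show "?j k w \<bullet> w' = - (w \<bullet> ?j k w')"
      using k \<open>linear (vol M p)\<close> by (auto simp: jop_def vol_skew j2_skew j2_vol)
    show "?c v (?j k w) = eps k *\<^sub>R ?j k (?c v w)"
      using k \<open>linear (vol M p)\<close> by (auto simp: jop_def eps_def j2 vol_c linear_neg)
  next
    fix w :: 'w
    show "?j 1 (?j 2 w) = ?j 3 w" "?j 2 (?j 1 w) = - ?j 3 w"
      by (simp_all add: jop_def j2_vol)
  next
    show "\<eta> p \<bullet> \<eta> p = 1" using assms(6) by (simp add: norm_eq_1)
    show "subspace (\<xi> p)" "dim (\<xi> p) = 4"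
      "(\<lambda>x. ?c x (\<eta> p)) ` \<xi> p = (span {\<eta> p, ?j 1 (\<eta> p), ?j 2 (\<eta> p), ?j 3 (\<eta> p)})\<^sup>\<bottom>"
      using assms(7) by (simp_all add: spinor_distribution_def rank4_subbundle_def)
  qed

  have J_eq: "Jop M j2 \<eta> \<xi> k p = s.J k" for k
    by (simp add: fun_eq_iff Jop_def s.J_def)
  have proj_eq: "proj M \<xi> p = s.pr"
    by (simp add: fun_eq_iff proj_def s.pr_def)
  have sharp_eq: "sharp M \<xi> (\<Theta> l) p = s.dual (\<Theta> l p)" for l
    by (simp add: sharp_def s.dual_def)

  \<comment> \<open>The action of \<open>R\<close> on \<eta>\<close>
  obtain b where b: "b \<in> \<xi> p" "?g b b = 1" by (rule s.unit_exists)
  have unf: "?g (R p) (R p) = 1" "\<And>x. x \<in> \<xi> p \<Longrightarrow> ?g (R p) x = 0"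
    "\<And>x y z w. x \<in> \<xi> p \<Longrightarrow> y \<in> \<xi> p \<Longrightarrow> z \<in> \<xi> p \<Longrightarrow> w \<in> \<xi> p \<Longrightarrow>
      wedge_square (omega M j2 \<eta> \<xi> 1 p) x y z w > 0 \<longleftrightarrow> det (vector [x, y, z, w, R p] :: real^5^5) > 0"
    using assms(8) unfolding unit_normal_field_def by blast+
  have unf2': "?g x (R p) = 0" if "x \<in> \<xi> p" for x
    using unf(2)[OF that] c.g_sym[of x "R p"] by simp
  have cR: "?c (R p) (\<eta> p) = - ?j 1 (\<eta> p)"
  proof -
    \<comment> \<open>The rows of \<open>B\<close> form a positive orthonormal basis of the tangent
      space; the rows of \<open>A\<close> are their coordinates in the frame, so \<open>A\<close> is
      orthogonal of determinant 1.\<close>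
    define B :: "real^5^5" where "B = vector [b, s.J 1 b, s.J 2 b, s.J 3 b, R p]"
    define A where "A = (\<chi> i. h (B $ i))"
    define P where "P A w = ?cl (A $ 1) (?cl (A $ 2) (?cl (A $ 3) (?cl (A $ 4) (?cl (A $ 5) w))))"
      for A :: "real^5^5" and w
    have Jb: "s.J k b \<in> \<xi> p" if "k \<in> {1..3}" for k using s.J(1)[OF that b(1)] .
    have "omega M j2 \<eta> \<xi> 1 p = (\<lambda>x y. ?g (s.J 1 (s.pr x)) (s.pr y))"
      by (simp add: fun_eq_iff omega_def J_eq proj_eq)
    then have "det B > 0"
      using unf(3)[OF b(1) Jb Jb Jb, of 1 2 3] s.wedge_square_basis[OF b] by (simp add: B_def)
    moreover have "B = (\<chi> i. f (A $ i))"
      by (simp add: vec_eq_iff A_def fh)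
    ultimately have "det A * det (matrix f) > 0"
      by (simp add: matrix_of_images[OF f(1)] det_mul)
    then have "det A > 0" using f(3) by (simp add: zero_less_mult_iff)
    moreover have "orthogonal_matrix A"
    proof -
      have g: "?g (s.J k b) (s.J l b) = (if k = l then 1 else 0)" if "k \<in> {1..3}" "l \<in> {1..3}" for k l
        using s.g_basis[OF b, of k l] that by (auto simp: s.basis_def split: if_splits)
      have g0: "?g b (s.J k b) = 0" "?g (s.J k b) b = 0" if "k \<in> {1..3}" for k
        using s.g_basis[OF b, of 0 k] s.g_basis[OF b, of k 0] that
        by (auto simp: s.basis_def split: if_splits)
      have "\<forall>i k. ?g (B $ i) (B $ k) = (if i = k then 1 else 0)"
        unfolding forall_5 B_def
        by (simp add: g g0 b unf(1,2) unf2' Jb)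
      then have "A $ i \<bullet> A $ k = (if i = k then 1 else 0)" for i k
        by (simp add: A_def gh)
      then show ?thesis
        by (auto simp: orthogonal_matrix_orthonormal_rows row_def orthogonal_def norm_eq_1)
    qed
    ultimately have "P A (\<eta> p) = P (mat 1) (\<eta> p)"
      using clifford_product_orthogonal[OF cl, of A "\<eta> p"] det_orthogonal_matrix[of A] by (auto simp: P_def)
    moreover have "P (mat 1) (\<eta> p) = vol M p (\<eta> p)"
    proof -
      have "mat 1 $ i = h (?e i)" for i :: 5
        by (simp add: h_e vec_eq_iff mat_def axis_def)
      then show ?thesis by (simp add: P_def vol_def c_eq)
    qed
    moreover have "P A (\<eta> p) = - ?c (R p) (\<eta> p)"
      using s.c_basis_product[OF b unf(2)] by (simp add: P_def A_def B_def c_eq)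
    ultimately have "- ?c (R p) (\<eta> p) = vol M p (\<eta> p)" by simp
    from arg_cong[OF this, of uminus] show ?thesis by (simp add: jop_def)
  qed

  \<comment> \<open>The decomposition of the covariant derivative at \<open>p\<close>\<close>
  note nd = assms(9)[unfolded nabla_decomposition_def endo_section_def form_section_def]
    and ed = assms(10)[unfolded endo_decomposition_def endo_section_def symmetric_within_def skew_within_def]
  have nab: "linear_within (\<xi> p) (S p)" "V p \<in> \<xi> p"
    "\<And>l. l \<in> {1..3} \<Longrightarrow> linear_within (\<xi> p) (\<Theta> l p)"
    using nd by simp_all
  have F: "spin_nabla M p x \<eta> = ?c (S p (s.pr x)) (\<eta> p) + ?g (R p) x *\<^sub>R ?c (V p) (\<eta> p)
      + (\<Sum>l\<in>{1..3}. (\<Theta> l p (s.pr x) + ?g (R p) x * \<phi> l p) *\<^sub>R ?j l (\<eta> p))" for x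
    using nd[THEN conjunct2, THEN conjunct2, THEN conjunct2, THEN conjunct2, rule_format, of p x]
    unfolding Let_def proj_eq .
  have S_eq: "S p x = \<mu> p *\<^sub>R x + (\<Sum>l\<in>{1..3}. Sl l p x) + (\<Sum>l\<in>{1..3}. lam l p *\<^sub>R s.J l x) + S0 p x"
    if "x \<in> \<xi> p" for x
    using ed[THEN conjunct2, THEN conjunct2, THEN conjunct2, THEN conjunct2, THEN conjunct1, rule_format, OF that]
    unfolding J_eq .
  have Sl: "Sl l p ` \<xi> p \<subseteq> \<xi> p" "traceless_within ?g (\<xi> p) (Sl l p)"
    "\<And>x y. x \<in> \<xi> p \<Longrightarrow> y \<in> \<xi> p \<Longrightarrow> ?g (Sl l p x) y = ?g x (Sl l p y)" if "l \<in> {1..3}" for l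
    using ed[THEN conjunct2, THEN conjunct2, THEN conjunct1]
      ed[THEN conjunct2, THEN conjunct2, THEN conjunct2, THEN conjunct2, THEN conjunct2, THEN conjunct1, rule_format, OF that, of p]
      that by simp_all
  have S0: "S0 p ` \<xi> p \<subseteq> \<xi> p"
    "\<And>x y. x \<in> \<xi> p \<Longrightarrow> y \<in> \<xi> p \<Longrightarrow> ?g (S0 p x) y = - ?g x (S0 p y)"
    "\<And>l x. l \<in> {1..3} \<Longrightarrow> x \<in> \<xi> p \<Longrightarrow> S0 p (s.J l x) = s.J l (S0 p x)"
    using ed[THEN conjunct2, THEN conjunct2, THEN conjunct2, THEN conjunct1]
      ed[THEN conjunct2, THEN conjunct2, THEN conjunct2, THEN conjunct2, THEN conjunct2, THEN conjunct2, rule_format, of p]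
    by (simp_all add: J_eq)
  note u = s.ortho_basis[OF b]
  have tr: "(\<Sum>i\<in>{..3}. ?g (Sl l p (s.basis b i)) (s.basis b i)) = 0" if l: "l \<in> {1..3}" for l
  proof -
    \<comment> \<open>Tracelessness refers to orthonormal bases as sets; injectivity of the family
      turns the sum over the set into a sum over indices.\<close>
    let ?B = "s.basis b ` {..3}"
    have "span ?B = \<xi> p"
      using u(2) s.subspace_L s.dim_L c.ortho_span(2)[OF u(1) _ u(2)] span_minimal[OF u(2) s.subspace_L]
      by auto
    moreover have "\<forall>x\<in>?B. \<forall>y\<in>?B. ?g x y = (if x = y then 1 else 0)"
      using s.g_basis[OF b] c.ortho_inj_on[OF u(1)] by (auto simp: inj_on_eq_iff)
    ultimately have "(\<Sum>x\<in>?B. ?g (Sl l p x) x) = 0"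
      using Sl(2)[OF l] u(2) unfolding traceless_within_def by blast
    then show ?thesis by (simp add: sum.reindex[OF c.ortho_inj_on[OF u(1)]])
  qed
  have "dirac M \<eta> p = (\<Sum>a\<in>UNIV. ?c (?e a) (spin_nabla M p (?e a) \<eta>))"
    by (simp add: dirac_def Let_def)
  then show ?thesis
    unfolding j_def J_def J_eq sharp_eq
    using s.dirac_formula[OF e _ b unf(2) cR F nab(2) nab(1) nab(3) S_eq Sl(1) Sl(3) tr S0] by simp
qed

end
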